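(* If $\mathcal H$ is an infinite-dimensional separable Hilbert space over $\mathbb K\in\{\mathbb R,\mathbb C,\mathbb H\}$, then every continuous unitary representation of the quotient group $\mathrm U(\mathcal H)/\mathrm U_\infty(\mathcal H)_0$ on a separable Hilbert space is trivial.
   Context: $\mathrm U(\mathcal H)$ is the group of surjective $\mathbb K$-linear isometries of $\mathcal H$ with the operator norm topology. $\mathrm U_\infty(\mathcal H)=\{g\in\mathrm U(\mathcal H): g-\mathbf 1\text{ compact}\}$, and $\mathrm U_\infty(\mathcal H)_0$ is its identity component, a closed normal subgroup of $\mathrm U(\mathcal H)$. The quotient carries the quotient topology. A unitary representation $\pi$ is continuous if all orbit maps $g\mapsto\pi(g)v$ are continuous. *)

theory Defs
  imports "HOL-Analysis.Analysis" "HOL-Algebra.Coset"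
begin

section \<open>Quaternions\<close>

datatype quat = Quat (qre: real) (qi: real) (qj: real) (qk: real)

lemma quat_eqI:
  "qre x = qre y \<Longrightarrow> qi x = qi y \<Longrightarrow> qj x = qj y \<Longrightarrow> qk x = qk y \<Longrightarrow> x = y"
  by (rule quat.expand) simp

instantiation quat :: real_algebra_1
begin

definition "0 = Quat 0 0 0 0"
definition "1 = Quat 1 0 0 0"
definition "x + y = Quat (qre x + qre y) (qi x + qi y) (qj x + qj y) (qk x + qk y)"
definition "- x = Quat (- qre x) (- qi x) (- qj x) (- qk x)"
definition "x - y = Quat (qre x - qre y) (qi x - qi y) (qj x - qj y) (qk x - qk y)"
definition "x * y = Quat
   (qre x * qre y - qi x * qi y - qj x * qj y - qk x * qk y)
   (qre x * qi y + qi x * qre y + qj x * qk y - qk x * qj y)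
   (qre x * qj y - qi x * qk y + qj x * qre y + qk x * qi y)
   (qre x * qk y + qi x * qj y - qj x * qi y + qk x * qre y)"
definition "r *\<^sub>R x = Quat (r * qre x) (r * qi x) (r * qj x) (r * qk x)"

instance
  by standard
    (auto intro!: quat_eqI simp: zero_quat_def one_quat_def plus_quat_def uminus_quat_def minus_quat_def
      times_quat_def scaleR_quat_def algebra_simps)

end

definition qcnj :: "quat \<Rightarrow> quat" where
  "qcnj x = Quat (qre x) (- qi x) (- qj x) (- qk x)"

lemma quaternion_relations:
  defines "i \<equiv> Quat 0 1 0 0" and "j \<equiv> Quat 0 0 1 0" and "k \<equiv> Quat 0 0 0 1"
  shows "i * i = - 1" "j * j = - 1" "k * k = - 1" "i * j = k" "j * i = - k"
    "j * k = i" "k * j = - i" "k * i = j" "i * k = - j"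
  by (simp_all add: assms times_quat_def uminus_quat_def one_quat_def)

lemma qcnj_mult: "qcnj (x * y) = qcnj y * qcnj x"
  by (simp add: qcnj_def times_quat_def algebra_simps)

lemma mult_qcnj:
  "x * qcnj x = of_real ((qre x)\<^sup>2 + (qi x)\<^sup>2 + (qj x)\<^sup>2 + (qk x)\<^sup>2)"
  by (simp add: qcnj_def times_quat_def of_real_def scaleR_quat_def one_quat_def power2_eq_square)


section \<open>Hilbert spaces over the reals, complex numbers and quaternions\<close>

text \<open>
  The parameter \<open>conj\<close> is the conjugation of the scalars: the identity on the reals, \<open>cnj\<close> on the
  complex numbers and \<open>qcnj\<close> on the quaternions.  Scalars act from the left and the inner
  product \<open>ip\<close> is linear in its first argument.  Completeness is part of the class \<open>banach\<close>;
  the last assumption says that its norm is the one given by \<open>ip\<close>.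
\<close>

locale hilbert_space =
  fixes conj :: "'k::real_algebra_1 \<Rightarrow> 'k"
    and smul :: "'k \<Rightarrow> 'h::banach \<Rightarrow> 'h"
    and ip :: "'h \<Rightarrow> 'h \<Rightarrow> 'k"
  assumes smul_add_right: "smul a (x + y) = smul a x + smul a y"
    and smul_add_left: "smul (a + b) x = smul a x + smul b x"
    and smul_smul: "smul a (smul b x) = smul (a * b) x"
    and smul_of_real: "smul (of_real r) x = r *\<^sub>R x"
    and ip_add_left: "ip (x + y) z = ip x z + ip y z"
    and ip_smul_left: "ip (smul a x) y = a * ip x y"
    and ip_commute: "ip y x = conj (ip x y)"
    and ip_self: "ip x x = of_real ((norm x)\<^sup>2)"

lemma hilbert_space_real_inner:
  "hilbert_space id scaleR (inner :: 'h::{real_inner,banach} \<Rightarrow> 'h \<Rightarrow> real)"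
  by (unfold_locales,
     simp_all add: scaleR_add_right scaleR_add_left inner_add_left power2_norm_eq_inner,
     simp add: inner_commute)

lemma hilbert_space_complex: "hilbert_space cnj (*) (\<lambda>x y :: complex. x * cnj y)"
  by unfold_locales
    (simp_all add: algebra_simps scaleR_conv_of_real complex_norm_square[symmetric] flip: of_real_power)

definition infinite_dimensional :: "('k \<Rightarrow> 'h::comm_monoid_add \<Rightarrow> 'h) \<Rightarrow> bool" where
  "infinite_dimensional smul \<longleftrightarrow>
     \<not> (\<exists>B. finite B \<and> (\<forall>x. \<exists>c. x = (\<Sum>b\<in>B. smul (c b) b)))"


section \<open>Unitary groups\<close>

text \<open>
  Elements are taken in the type of bounded real-linear operators, whose norm is the operator norm,
  so that the metric topology of that type induces the operator norm topology.
\<close>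

definition unitaries :: "('k \<Rightarrow> 'h::real_normed_vector \<Rightarrow> 'h) \<Rightarrow> ('h \<Rightarrow>\<^sub>L 'h) set" where
  "unitaries smul = {g. (\<forall>a x. blinfun_apply g (smul a x) = smul a (blinfun_apply g x)) \<and>
     (\<forall>x. norm (blinfun_apply g x) = norm x) \<and> surj (blinfun_apply g)}"

definition unitary_group ::
    "('k \<Rightarrow> 'h::real_normed_vector \<Rightarrow> 'h) \<Rightarrow> ('h \<Rightarrow>\<^sub>L 'h) monoid" where
  "unitary_group smul =
     \<lparr>carrier = unitaries smul, mult = blinfun_compose, one = id_blinfun\<rparr>"

definition compact_operator :: "('a::real_normed_vector \<Rightarrow>\<^sub>L 'b::real_normed_vector) \<Rightarrow> bool" where
  "compact_operator T \<longleftrightarrow> (\<forall>S. bounded S \<longrightarrow> compact (closure (blinfun_apply T ` S)))"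

definition unitaries_compact :: "('k \<Rightarrow> 'h::real_normed_vector \<Rightarrow> 'h) \<Rightarrow> ('h \<Rightarrow>\<^sub>L 'h) set" where
  "unitaries_compact smul = {g \<in> unitaries smul. compact_operator (g - id_blinfun)}"

definition unitaries_compact_0 :: "('k \<Rightarrow> 'h::real_normed_vector \<Rightarrow> 'h) \<Rightarrow> ('h \<Rightarrow>\<^sub>L 'h) set" where
  "unitaries_compact_0 smul = connected_component_set (unitaries_compact smul) id_blinfun"


section \<open>The quotient group and its topology\<close>

definition quotient_topology :: "'a topology \<Rightarrow> ('a \<Rightarrow> 'b) \<Rightarrow> 'b topology" where
  "quotient_topology X q =
     topology (\<lambda>V. V \<subseteq> q ` topspace X \<and> openin X {x \<in> topspace X. q x \<in> V})"

lemma openin_quotient_topology: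
  "openin (quotient_topology X q) V \<longleftrightarrow>
     V \<subseteq> q ` topspace X \<and> openin X {x \<in> topspace X. q x \<in> V}"
proof -
  have "istopology (\<lambda>V. V \<subseteq> q ` topspace X \<and> openin X {x \<in> topspace X. q x \<in> V})"
    unfolding istopology_def
  proof (intro conjI allI impI)
    fix S T
    assume S: "S \<subseteq> q ` topspace X \<and> openin X {x \<in> topspace X. q x \<in> S}"
      and T: "T \<subseteq> q ` topspace X \<and> openin X {x \<in> topspace X. q x \<in> T}"
    have "{x \<in> topspace X. q x \<in> S \<inter> T} =
        {x \<in> topspace X. q x \<in> S} \<inter> {x \<in> topspace X. q x \<in> T}" by auto
    then show "openin X {x \<in> topspace X. q x \<in> S \<inter> T}" using S T by (simp add: openin_Int)
    show "S \<inter> T \<subseteq> q ` topspace X" using S by auto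
  next
    fix K
    assume K: "\<forall>S\<in>K. S \<subseteq> q ` topspace X \<and> openin X {x \<in> topspace X. q x \<in> S}"
    have "{x \<in> topspace X. q x \<in> \<Union> K} = (\<Union>S\<in>K. {x \<in> topspace X. q x \<in> S})" by auto
    then show "openin X {x \<in> topspace X. q x \<in> \<Union> K}" using K by auto
    show "\<Union> K \<subseteq> q ` topspace X" using K by blast
  qed
  then show ?thesis by (simp add: quotient_topology_def)
qed

lemma topspace_quotient_topology: "topspace (quotient_topology X q) = q ` topspace X"
proof
  show "topspace (quotient_topology X q) \<subseteq> q ` topspace X"
    using openin_topspace[of "quotient_topology X q"] unfolding openin_quotient_topology by blast
  have "{x \<in> topspace X. q x \<in> q ` topspace X} = topspace X" by auto
  then have "openin (quotient_topology X q) (q ` topspace X)"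
    by (simp add: openin_quotient_topology)
  then show "q ` topspace X \<subseteq> topspace (quotient_topology X q)" by (rule openin_subset)
qed

lemma quotient_map_quotient_topology: "quotient_map X (quotient_topology X q) q"
  by (simp add: quotient_map_def topspace_quotient_topology openin_quotient_topology)

definition unitary_quotient ::
    "('k \<Rightarrow> 'h::real_normed_vector \<Rightarrow> 'h) \<Rightarrow> ('h \<Rightarrow>\<^sub>L 'h) set monoid" where
  "unitary_quotient smul = unitary_group smul Mod unitaries_compact_0 smul"

definition unitary_quotient_topology ::
    "('k \<Rightarrow> 'h::real_normed_vector \<Rightarrow> 'h) \<Rightarrow> ('h \<Rightarrow>\<^sub>L 'h) set topology" where
  "unitary_quotient_topology smul =
     quotient_topology (top_of_set (unitaries smul))
       (\<lambda>g. unitaries_compact_0 smul #>\<^bsub>unitary_group smul\<^esub> g)"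

lemma topspace_unitary_quotient_topology:
  "topspace (unitary_quotient_topology smul) = carrier (unitary_quotient smul)"
  by (auto simp: unitary_quotient_topology_def unitary_quotient_def topspace_quotient_topology
      FactGroup_def RCOSETS_def unitary_group_def)


section \<open>Continuous unitary representations\<close>

definition continuous_unitary_rep ::
    "('g, 'm) monoid_scheme \<Rightarrow> 'g topology \<Rightarrow> (complex \<Rightarrow> 'v::real_normed_vector \<Rightarrow> 'v)
      \<Rightarrow> ('g \<Rightarrow> ('v \<Rightarrow>\<^sub>L 'v)) \<Rightarrow> bool" where
  "continuous_unitary_rep G T smul \<pi> \<longleftrightarrow>
     \<pi> \<in> hom G (unitary_group smul) \<and>
     (\<forall>v. continuous_map T euclidean (\<lambda>g. blinfun_apply (\<pi> g) v))"

definition trivial_rep :: "('g, 'm) monoid_scheme \<Rightarrow> ('g \<Rightarrow> ('v::real_normed_vector \<Rightarrow>\<^sub>L 'v)) \<Rightarrow> bool"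
  where "trivial_rep G \<pi> \<longleftrightarrow> (\<forall>g\<in>carrier G. \<pi> g = id_blinfun)"

end

theory Submission
  imports Defs
begin

text \<open>
  A representation of the quotient is pulled back to a homomorphism \<open>\<rho>\<close> from the unitary group of
  \<open>H\<close> to the one of \<open>V\<close> that is trivial on the identity component of the compact perturbations of
  the identity, in particular on rotations in finitely many planes.  The proof shows that the
  kernel of \<open>\<rho>\<close> contains one rotation of infinite rank, and that such a rotation normally generates
  the whole unitary group.

  An orthonormal basis of \<open>H\<close> is grouped into planes indexed by the natural numbers.  For a set
  \<open>A\<close> of indices let \<open>R A t\<close> be the rotation by the angle \<open>t\<close> in all planes with index in \<open>A\<close>.
  Modulo the kernel this depends only on \<open>A\<close> up to finite sets, so \<open>R A t\<close> and \<open>R B t\<close> have the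
  product \<open>R (A \<union> B) t\<close> if \<open>A \<inter> B\<close> is finite.  Moreover \<open>R A t\<close> is close to the identity for small
  \<open>t\<close>, uniformly in \<open>A\<close>.  Take an uncountable family of infinite sets \<open>A X\<close> with finite pairwise
  intersections.  For a vector \<open>v\<close> of \<open>V\<close> and a small angle \<open>t\<close> all products of operators
  \<open>\<rho> (R (A X) t)\<close> over finite sets of \<open>X\<close> then move \<open>v\<close> only a little, which forces all but
  countably many of these operators to fix a vector \<open>w\<close> near \<open>v\<close> (\<open>fixed_vector_nearby\<close>).  If \<open>t\<close> is a fraction of the right angle, the right
  angle rotations fix \<open>w\<close> as well.  As \<open>V\<close> is separable, countably many vectors \<open>w\<close> are dense, so
  for some \<open>X\<close> the rotation of \<open>A X\<close> by the right angle acts trivially (\<open>rotation_in_kernel\<close>).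

  Conjugation turns this rotation into every operator that sends \<open>x\<^sub>i\<close> to \<open>y\<^sub>i\<close> and \<open>y\<^sub>i\<close> to
  \<open>- x\<^sub>i\<close> for infinitely many orthonormal vectors and fixes an infinite-dimensional complement
  (\<open>signed_swap_in_N\<close>).  Products of two such operators agree with a given unitary operator on some
  orthonormal sequence (\<open>agrees_on_sequence\<close>), which leaves the unitary operators that fix an
  orthonormal sequence.  These are obtained from conjugates of one operator that acts on infinitely many
  copies of the complement (\<open>fixes_sequence_in_N\<close>).
\<close>

section \<open>Hilbert spaces over a scalar ring with conjugation\<close>

text \<open>
  The three scalar rings are treated at once.  The function \<open>nsq\<close> is the square of the absolute
  value.  The last assumption says that the scalars are finite-dimensional over the reals; it makes
  operators of finite rank compact.
\<close>

locale conj_hilbert_space = hilbert_space conj smul ip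
  for conj :: "'k::real_algebra_1 \<Rightarrow> 'k" and smul :: "'k \<Rightarrow> 'h::banach \<Rightarrow> 'h" and ip :: "'h \<Rightarrow> 'h \<Rightarrow> 'k" +
  fixes nsq :: "'k \<Rightarrow> real"
  assumes conj_add: "conj (a + b) = conj a + conj b"
    and conj_mult: "conj (a * b) = conj b * conj a"
    and conj_conj: "conj (conj a) = a"
    and conj_of_real: "conj (of_real r) = of_real r"
    and mult_conj: "a * conj a = of_real (nsq a)"
    and nsq_nonneg: "0 \<le> nsq a"
    and nsq_zeroD: "nsq a = 0 \<Longrightarrow> a = 0"
    and scalars_finite_dim:
      "\<exists>L. finite L \<and> (\<forall>a. \<exists>t. a = (\<Sum>l\<in>L. t l *\<^sub>R l) \<and> (\<forall>l\<in>L. (t l)\<^sup>2 \<le> nsq a))"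
begin

lemma conj_zero [simp]: "conj 0 = 0" and conj_one [simp]: "conj 1 = 1"
  using conj_of_real[of 0] conj_of_real[of 1] by simp_all

lemma nsq_zero [simp]: "nsq 0 = 0"
  using mult_conj[of 0] by simp

lemma nsq_eq_zero_iff: "nsq a = 0 \<longleftrightarrow> a = 0"
  using nsq_zeroD by auto

lemma ip_add_right: "ip x (y + z) = ip x y + ip x z"
  by (metis conj_add ip_add_left ip_commute)

lemma ip_smul_right: "ip x (smul a y) = ip x y * conj a"
  by (metis conj_mult ip_commute ip_smul_left)

lemma ip_zero_left [simp]: "ip 0 x = 0"
  using ip_add_left[of 0 0 x] by simp

lemma ip_zero_right [simp]: "ip x 0 = 0"
  using ip_add_right[of x 0 0] by simp

lemma ip_minus_left [simp]: "ip (- x) y = - ip x y"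
  using ip_add_left[of x "- x" y] by (simp add: eq_neg_iff_add_eq_0 add.commute)

lemma ip_minus_right [simp]: "ip x (- y) = - ip x y"
  using ip_add_right[of x y "- y"] by (simp add: eq_neg_iff_add_eq_0 add.commute)

lemma ip_diff_left: "ip (x - y) z = ip x z - ip y z"
  using ip_add_left[of x "- y" z] by simp

lemma ip_diff_right: "ip x (y - z) = ip x y - ip x z"
  using ip_add_right[of x y "- z"] by simp

lemma ip_scaleR_left [simp]: "ip (r *\<^sub>R x) y = r *\<^sub>R ip x y"
  by (metis ip_smul_left smul_of_real scaleR_conv_of_real)

lemma of_real_central: "a * of_real r = of_real r * (a::'k)"
  by (simp add: of_real_def)

lemma ip_scaleR_right [simp]: "ip x (r *\<^sub>R y) = r *\<^sub>R ip x y"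
  by (metis ip_smul_right smul_of_real scaleR_conv_of_real conj_of_real of_real_central)

lemma ip_sum_left: "ip (sum f A) y = (\<Sum>i\<in>A. ip (f i) y)"
  by (induction A rule: infinite_finite_induct) (simp_all add: ip_add_left)

lemma ip_zero_sym: "ip x y = 0 \<Longrightarrow> ip y x = 0"
  by (metis conj_zero ip_commute)

lemma smul_one [simp]: "smul 1 x = x"
  using smul_of_real[of 1 x] by simp

lemma smul_zero_left [simp]: "smul 0 x = 0"
  using smul_of_real[of 0 x] by simp

lemma smul_zero_right [simp]: "smul a 0 = 0"
  using smul_add_right[of a 0 0] by simp

lemma smul_minus_right: "smul a (- x) = - smul a x"
  using smul_add_right[of a x "- x"] by (simp add: eq_neg_iff_add_eq_0 add.commute)

lemma smul_diff_right: "smul a (x - y) = smul a x - smul a y"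
  using smul_add_right[of a x "- y"] by (simp add: smul_minus_right)

lemma smul_scaleR: "smul a (r *\<^sub>R x) = r *\<^sub>R smul a x"
  by (metis smul_smul smul_of_real of_real_central)

lemma smul_scaleR_left: "smul (r *\<^sub>R a) x = r *\<^sub>R smul a x"
  by (metis smul_smul smul_of_real scaleR_conv_of_real)

lemma smul_sum_left: "smul (sum f A) x = (\<Sum>i\<in>A. smul (f i) x)"
  by (induction A rule: infinite_finite_induct) (simp_all add: smul_add_left)

lemma norm_smul: "(norm (smul a x))\<^sup>2 = nsq a * (norm x)\<^sup>2"
proof -
  have "(of_real ((norm (smul a x))\<^sup>2) :: 'k) = a * ip x x * conj a"
    by (simp only: ip_self[symmetric] ip_smul_left ip_smul_right mult.assoc)
  also have "\<dots> = of_real ((norm x)\<^sup>2) * (a * conj a)"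
    by (simp only: ip_self of_real_central[of a] mult.assoc)
  also have "\<dots> = of_real (nsq a * (norm x)\<^sup>2)"
    by (simp only: mult_conj of_real_mult[symmetric] mult.commute)
  finally show ?thesis by (simp only: of_real_eq_iff)
qed

lemma norm_add_orth:
  assumes "ip x y = 0" shows "(norm (x + y))\<^sup>2 = (norm x)\<^sup>2 + (norm y)\<^sup>2"
proof -
  have "ip (x + y) (x + y) = ip x x + ip y y"
    using assms ip_zero_sym[OF assms] by (simp add: ip_add_left ip_add_right)
  then have "(of_real ((norm (x + y))\<^sup>2) :: 'k) = of_real ((norm x)\<^sup>2 + (norm y)\<^sup>2)"
    by (simp only: ip_self of_real_add)
  then show ?thesis by (simp only: of_real_eq_iff)
qed

lemma parallelogram:
  fixes x y :: 'h
  shows "(norm (x + y))\<^sup>2 + (norm (x - y))\<^sup>2 = 2 * (norm x)\<^sup>2 + 2 * (norm y)\<^sup>2"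
proof -
  have "ip (x + y) (x + y) + ip (x - y) (x - y) = 2 *\<^sub>R ip x x + 2 *\<^sub>R ip y y"
    by (simp add: ip_add_left ip_add_right ip_diff_left ip_diff_right scaleR_2)
  then have "(of_real ((norm (x + y))\<^sup>2 + (norm (x - y))\<^sup>2) :: 'k)
      = of_real (2 * (norm x)\<^sup>2 + 2 * (norm y)\<^sup>2)"
    by (simp only: ip_self of_real_add of_real_mult scaleR_conv_of_real)
  then show ?thesis by (simp only: of_real_eq_iff)
qed


section \<open>Orthonormal families and bases\<close>

definition orthonormal :: "'i set \<Rightarrow> ('i \<Rightarrow> 'h) \<Rightarrow> bool" where
  "orthonormal I e \<longleftrightarrow> (\<forall>i\<in>I. \<forall>j\<in>I. ip (e i) (e j) = (if i = j then 1 else 0))"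

text \<open>
  A basis is characterized by the triviality of the orthogonal complement instead of the density of
  the span.  By completeness the two conditions agree, and this one is easy to verify for families
  built from a given basis.
\<close>
definition onb :: "'i set \<Rightarrow> ('i \<Rightarrow> 'h) \<Rightarrow> bool" where
  "onb I e \<longleftrightarrow> orthonormal I e \<and> (\<forall>x. (\<forall>i\<in>I. ip x (e i) = 0) \<longrightarrow> x = 0)"

lemma onb_orthonormal: "onb I e \<Longrightarrow> orthonormal I e"
  by (simp add: onb_def)

lemma onb_total: "onb I e \<Longrightarrow> (\<And>i. i \<in> I \<Longrightarrow> ip x (e i) = 0) \<Longrightarrow> x = 0"
  by (simp add: onb_def)

lemma orthonormal_same: "orthonormal I e \<Longrightarrow> i \<in> I \<Longrightarrow> ip (e i) (e i) = 1"
  by (simp add: orthonormal_def)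

lemma orthonormal_diff: "orthonormal I e \<Longrightarrow> i \<in> I \<Longrightarrow> j \<in> I \<Longrightarrow> i \<noteq> j \<Longrightarrow> ip (e i) (e j) = 0"
  by (simp add: orthonormal_def)

lemma ip_self_one_iff: "ip x x = 1 \<longleftrightarrow> norm x = 1"
proof -
  have "ip x x = 1 \<longleftrightarrow> (of_real ((norm x)\<^sup>2) :: 'k) = of_real 1" by (simp add: ip_self)
  also have "\<dots> \<longleftrightarrow> norm x = 1" by (simp only: of_real_eq_iff) (smt (verit) norm_ge_zero power2_eq_1_iff)
  finally show ?thesis .
qed

lemma orthonormal_norm: "orthonormal I e \<Longrightarrow> i \<in> I \<Longrightarrow> norm (e i) = 1"
  using orthonormal_same[of I e i] ip_self_one_iff[of "e i"] by simp

lemma orthonormal_inj: "orthonormal I e \<Longrightarrow> inj_on e I"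
  unfolding orthonormal_def by (intro inj_onI) (metis zero_neq_one)

lemma orthonormal_reindex:
  assumes "orthonormal I e" "inj_on s J" "s ` J \<subseteq> I" shows "orthonormal J (\<lambda>j. e (s j))"
  using assms unfolding orthonormal_def by (auto simp: inj_on_def image_subset_iff)

lemma onb_reindex:
  assumes "onb I e" "bij_betw s J I" shows "onb J (\<lambda>j. e (s j))"
proof -
  have "I = s ` J" using assms by (simp add: bij_betw_def)
  then show ?thesis
    using assms orthonormal_reindex[of I e s J] by (auto simp: onb_def bij_betw_def)
qed

lemma norm_sum_orthonormal:
  assumes "orthonormal I e" "finite F" "F \<subseteq> I"
  shows "(norm (\<Sum>i\<in>F. smul (c i) (e i)))\<^sup>2 = (\<Sum>i\<in>F. nsq (c i))"
  using assms(2,3)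
proof (induction F rule: finite_induct)
  case (insert j F)
  have "ip (\<Sum>i\<in>F. smul (c i) (e i)) (smul (c j) (e j)) = 0"
    unfolding ip_sum_left
    by (rule sum.neutral) (use insert assms in \<open>auto simp: ip_smul_left ip_smul_right orthonormal_def\<close>)
  then have "(norm (smul (c j) (e j) + (\<Sum>i\<in>F. smul (c i) (e i))))\<^sup>2
      = (norm (smul (c j) (e j)))\<^sup>2 + (norm (\<Sum>i\<in>F. smul (c i) (e i)))\<^sup>2"
    by (intro norm_add_orth) (rule ip_zero_sym)
  then show ?case
    using insert assms orthonormal_norm[OF assms(1), of j] by (simp add: norm_smul)
qed simp

lemma ip_sum_orthonormal:
  assumes "orthonormal I e" "finite F" "F \<subseteq> I" "j \<in> I"
  shows "ip (\<Sum>i\<in>F. smul (c i) (e i)) (e j) = (if j \<in> F then c j else 0)"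
proof -
  have "ip (\<Sum>i\<in>F. smul (c i) (e i)) (e j) = (\<Sum>i\<in>F. if i = j then c i else 0)"
    unfolding ip_sum_left ip_smul_left
    by (rule sum.cong) (use assms in \<open>auto simp: orthonormal_def\<close>)
  then show ?thesis using assms(2) by simp
qed

text \<open>The difference of a vector and its partial expansion is orthogonal to the partial expansion.\<close>
lemma bessel:
  assumes "orthonormal I e" "finite F" "F \<subseteq> I"
  shows "(\<Sum>i\<in>F. nsq (ip x (e i))) \<le> (norm x)\<^sup>2"
proof -
  define s where "s = (\<Sum>i\<in>F. smul (ip x (e i)) (e i))"
  have "ip (x - s) (e j) = 0" if "j \<in> F" for j
    using ip_sum_orthonormal[OF assms, of j "\<lambda>i. ip x (e i)"] that assms(3)
    by (auto simp: ip_diff_left s_def)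
  then have "ip s (x - s) = 0"
    unfolding s_def ip_sum_left ip_smul_left by (simp add: ip_zero_sym)
  then have "(norm (s + (x - s)))\<^sup>2 = (norm s)\<^sup>2 + (norm (x - s))\<^sup>2" by (rule norm_add_orth)
  moreover have "(norm s)\<^sup>2 = (\<Sum>i\<in>F. nsq (ip x (e i)))"
    unfolding s_def by (rule norm_sum_orthonormal[OF assms])
  ultimately have "(norm x)\<^sup>2 = (\<Sum>i\<in>F. nsq (ip x (e i))) + (norm (x - s))\<^sup>2"
    by simp
  then show ?thesis by simp
qed

text \<open>
  This is Bessel's inequality for the single vector \<open>y\<close> after normalization.
\<close>
lemma cauchy_schwarz: "nsq (ip x y) \<le> (norm x)\<^sup>2 * (norm y)\<^sup>2"
proof (cases "y = 0")
  case False
  define e where "e = y /\<^sub>R norm y"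
  have "norm e = 1" using False by (simp add: e_def)
  then have "orthonormal {()} (\<lambda>_. e)" by (simp add: orthonormal_def ip_self_one_iff)
  from bessel[OF this, of "{()}" x] have b: "nsq (ip x e) \<le> (norm x)\<^sup>2" by simp
  have y: "y = smul (of_real (norm y)) e" using False by (simp add: e_def smul_of_real)
  have "ip x y = norm y *\<^sub>R ip x e"
    by (subst y) (simp add: ip_smul_right conj_of_real of_real_central flip: scaleR_conv_of_real)
  then have "smul (ip x y) e = norm y *\<^sub>R smul (ip x e) e" by (simp add: smul_scaleR_left)
  then have "(norm (smul (ip x y) e))\<^sup>2 = (norm y)\<^sup>2 * (norm (smul (ip x e) e))\<^sup>2"
    by (simp add: power_mult_distrib)
  then have "nsq (ip x y) = (norm y)\<^sup>2 * nsq (ip x e)"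
    using \<open>norm e = 1\<close> by (simp add: norm_smul)
  also have "\<dots> \<le> (norm y)\<^sup>2 * (norm x)\<^sup>2" by (intro mult_left_mono b) simp
  finally show ?thesis by (simp add: mult.commute)
qed simp

text \<open>
  The Cauchy--Schwarz inequality makes \<open>\<lambda>s. ip s y\<close> continuous.  The estimate is spelled out since no
  topology is given on the scalars.
\<close>
lemma ip_has_sum_zero:
  assumes "(f has_sum s) I" "\<And>i. i \<in> I \<Longrightarrow> ip (f i) y = 0" shows "ip s y = 0"
proof -
  have "nsq (ip s y) \<le> d" if "d > 0" for d
  proof -
    define r where "r = sqrt d / (norm y + 1)"
    have "norm y + 1 > 0" by (smt (verit) norm_ge_zero)
    then have "r > 0" using that by (simp add: r_def)
    from has_sum_finite_approximation[OF assms(1) this]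
    obtain F where F: "finite F" "F \<subseteq> I" "dist (sum f F) s \<le> r" by blast
    have "ip (sum f F) y = 0"
      unfolding ip_sum_left by (rule sum.neutral) (use F assms in auto)
    then have "nsq (ip s y) = nsq (ip (s - sum f F) y)" by (simp add: ip_diff_left)
    also have "\<dots> \<le> (norm (s - sum f F))\<^sup>2 * (norm y)\<^sup>2" by (rule cauchy_schwarz)
    also have "\<dots> = (norm (s - sum f F) * norm y)\<^sup>2" by (simp add: power_mult_distrib)
    also have "\<dots> \<le> (r * (norm y + 1))\<^sup>2"
      using F(3) \<open>r > 0\<close> by (intro power_mono mult_mono) (auto simp: dist_norm norm_minus_commute)
    also have "r * (norm y + 1) = sqrt d" using \<open>norm y + 1 > 0\<close> by (simp add: r_def)
    also have "(sqrt d)\<^sup>2 = d" using that by simp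
    finally show ?thesis .
  qed
  then have "nsq (ip s y) \<le> 0" by (rule field_le_epsilon[of _ 0, simplified])
  then show ?thesis using nsq_nonneg by (rule nsq_zeroD[OF order_antisym])
qed

lemma riesz_fischer:
  assumes e: "orthonormal I e" and bd: "\<And>F. finite F \<Longrightarrow> F \<subseteq> I \<Longrightarrow> (\<Sum>i\<in>F. nsq (c i)) \<le> M"
  shows "\<exists>s. ((\<lambda>i. smul (c i) (e i)) has_sum s) I \<and> (\<forall>j\<in>I. ip s (e j) = c j)"
proof -
  define f where "f = (\<lambda>i. smul (c i) (e i))"
  have "(\<lambda>i. nsq (c i)) summable_on I"
    by (rule nonneg_bounded_partial_sums_imp_summable_on[where C = M])
      (auto simp: nsq_nonneg eventually_finite_subsets_at_top intro!: bd exI[of _ "{}"])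
  then obtain S where S: "((\<lambda>i. nsq (c i)) has_sum S) I" by (auto simp: summable_on_def)
  have "\<exists>P. eventually P (finite_subsets_at_top I) \<and>
              (\<forall>F F'. P F \<and> P F' \<longrightarrow> dist (sum f F) (sum f F') < d)" if "d > 0" for d
  proof -
    \<comment> \<open>The tails of the series of squares control the tails of the vector series.\<close>
    have "(d / 2)\<^sup>2 / 4 > 0" using that by simp
    from has_sum_finite_approximation[OF S this]
    obtain G where G: "finite G" "G \<subseteq> I" "\<bar>(\<Sum>i\<in>G. nsq (c i)) - S\<bar> \<le> (d/2)\<^sup>2 / 4"
      by (auto simp: dist_real_def)
    have tail: "norm (sum f H) < d / 2" if H: "finite H" "H \<subseteq> I - G" for H
    proof -
      have "(\<Sum>i\<in>G \<union> H. nsq (c i)) \<le> S"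
        by (rule has_sum_mono_neutral[OF has_sum_finite S])
          (use G H in \<open>auto simp: nsq_nonneg\<close>)
      moreover have "(\<Sum>i\<in>G \<union> H. nsq (c i)) = (\<Sum>i\<in>G. nsq (c i)) + (\<Sum>i\<in>H. nsq (c i))"
        using G H by (intro sum.union_disjoint) auto
      ultimately have "(\<Sum>i\<in>H. nsq (c i)) \<le> (d/2)\<^sup>2 / 4" using G(3) by linarith
      moreover have "(norm (sum f H))\<^sup>2 = (\<Sum>i\<in>H. nsq (c i))"
        unfolding f_def using H by (intro norm_sum_orthonormal[OF e]) auto
      ultimately have "(norm (sum f H))\<^sup>2 < (d/2)\<^sup>2"
        using \<open>(d / 2)\<^sup>2 / 4 > 0\<close> by linarith
      then show ?thesis using \<open>d > 0\<close> by (metis power2_less_imp_less half_gt_zero less_imp_le)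
    qed
    have split: "dist (sum f F) (sum f G) < d / 2" if "finite F" "G \<subseteq> F" "F \<subseteq> I" for F
    proof -
      have "sum f F - sum f G = sum f (F - G)" using that by (simp add: sum_diff)
      then show ?thesis using tail[of "F - G"] that by (auto simp: dist_norm)
    qed
    show ?thesis
    proof (intro exI[of _ "\<lambda>F. finite F \<and> G \<subseteq> F \<and> F \<subseteq> I"] conjI allI impI)
      show "\<forall>\<^sub>F F in finite_subsets_at_top I. finite F \<and> G \<subseteq> F \<and> F \<subseteq> I"
        using G unfolding eventually_finite_subsets_at_top by blast
      fix F F' assume "(finite F \<and> G \<subseteq> F \<and> F \<subseteq> I) \<and> (finite F' \<and> G \<subseteq> F' \<and> F' \<subseteq> I)"
      then show "dist (sum f F) (sum f F') < d"
        using split[of F] split[of F'] by (metis dist_commute dist_triangle_half_l)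
    qed
  qed
  then have "cauchy_filter (filtermap (sum f) (finite_subsets_at_top I))"
    by (simp add: cauchy_filter_metric_filtermap)
  moreover have "complete (UNIV :: 'h set)"
    by (meson Cauchy_convergent UNIV_I complete_def convergent_def)
  ultimately obtain s where "(sum f \<longlongrightarrow> s) (finite_subsets_at_top I)"
    using complete_uniform[where S=UNIV] by (force simp add: filterlim_def)
  then have s: "(f has_sum s) I" by (simp add: has_sum_def)
  have "ip s (e j) = c j" if "j \<in> I" for j
  proof -
    have "ip (s - f j) (e j) = 0"
    proof (rule ip_has_sum_zero)
      have "(f has_sum f j) {j}" by (simp add: has_sum_finite_iff)
      then show "(f has_sum (s - f j)) (I - {j})"
        by (rule has_sum_Diff[OF s]) (use that in auto)
      show "ip (f i) (e j) = 0" if "i \<in> I - {j}" for i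
        using that \<open>j \<in> I\<close> e by (simp add: f_def ip_smul_left orthonormal_def)
    qed
    then show ?thesis using e that by (simp add: f_def ip_diff_left ip_smul_left orthonormal_def)
  qed
  then show ?thesis using s unfolding f_def by blast
qed

lemma onb_expansion:
  assumes "onb I e" shows "((\<lambda>i. smul (ip x (e i)) (e i)) has_sum x) I"
proof -
  from riesz_fischer[OF onb_orthonormal[OF assms], of "\<lambda>i. ip x (e i)" "(norm x)\<^sup>2"]
  obtain s where s: "((\<lambda>i. smul (ip x (e i)) (e i)) has_sum s) I"
      "\<And>j. j \<in> I \<Longrightarrow> ip s (e j) = ip x (e j)"
    using bessel[OF onb_orthonormal[OF assms]] by blast
  have "x - s = 0"
    by (rule onb_total[OF assms]) (simp add: ip_diff_left s)
  then show ?thesis using s by simp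
qed

text \<open>
  Vectors are orthogonal if no basis vector occurs in both expansions.
\<close>
lemma onb_ip_zero:
  assumes "onb I e" "\<And>i. i \<in> I \<Longrightarrow> ip x (e i) = 0 \<or> ip (e i) y = 0" shows "ip x y = 0"
  by (rule ip_has_sum_zero[OF onb_expansion[OF assms(1)]])
    (use assms(2) in \<open>force simp: ip_smul_left\<close>)

definition scalar_linear :: "('h \<Rightarrow>\<^sub>L 'h) \<Rightarrow> bool" where
  "scalar_linear T \<longleftrightarrow> (\<forall>a x. blinfun_apply T (smul a x) = smul a (blinfun_apply T x))"

text \<open>
  The hypothesis asks for agreement only on the basis vectors that occur in the expansion of \<open>x\<close>.
  In this form the lemma compares operators on the closed span of a part of the basis.
\<close>
lemma scalar_linear_agree:
  assumes "onb I e" "scalar_linear S" "scalar_linear T"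
    "\<And>i. i \<in> I \<Longrightarrow> ip x (e i) = 0 \<or> blinfun_apply S (e i) = blinfun_apply T (e i)"
  shows "blinfun_apply S x = blinfun_apply T x"
proof -
  have sum: "((\<lambda>i. smul (ip x (e i)) (blinfun_apply U (e i))) has_sum blinfun_apply U x) I"
    if "scalar_linear U" for U
    using has_sum_bounded_linear[OF blinfun.bounded_linear_right[of U] onb_expansion[OF assms(1), of x]]
      that by (simp add: scalar_linear_def)
  have "((\<lambda>i. smul (ip x (e i)) (blinfun_apply S (e i))) has_sum blinfun_apply T x) I"
    using sum[OF assms(3)] by (rule has_sum_cong[THEN iffD1, rotated]) (use assms(4) in force)
  then show ?thesis using sum[OF assms(2)] has_sum_unique by blast
qed

lemma scalar_linear_eqI:
  assumes "onb I e" "scalar_linear S" "scalar_linear T"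
    "\<And>i. i \<in> I \<Longrightarrow> blinfun_apply S (e i) = blinfun_apply T (e i)"
  shows "S = T"
  by (rule blinfun_eqI, rule scalar_linear_agree[OF assms(1-3)]) (use assms(4) in auto)

end

context conj_hilbert_space begin

text \<open>
  An orthonormal set that is maximal by Zorn's lemma has no unit vector orthogonal to it.
\<close>
lemma onb_extend:
  assumes "orthonormal A (\<lambda>b. b)" shows "\<exists>B. A \<subseteq> B \<and> onb B (\<lambda>b. b)"
proof -
  define \<A> where "\<A> = {B. A \<subseteq> B \<and> orthonormal B (\<lambda>b. b)}"
  have "\<exists>M\<in>\<A>. \<forall>X\<in>\<A>. M \<subseteq> X \<longrightarrow> X = M"
  proof (rule subset_Zorn_nonempty)
    show "\<A> \<noteq> {}" using assms by (auto simp: \<A>_def)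
    fix \<C> assume C: "\<C> \<noteq> {}" "subset.chain \<A> \<C>"
    then have sub: "\<C> \<subseteq> \<A>" and lin: "\<And>X Y. X \<in> \<C> \<Longrightarrow> Y \<in> \<C> \<Longrightarrow> X \<subseteq> Y \<or> Y \<subseteq> X"
      by (auto simp: subset.chain_def)
    have "ip x y = (if x = y then 1 else 0)" if xy: "x \<in> \<Union>\<C>" "y \<in> \<Union>\<C>" for x y
    proof -
      obtain X Y where X: "X \<in> \<C>" "x \<in> X" and Y: "Y \<in> \<C>" "y \<in> Y" using xy by blast
      obtain Z where Z: "Z \<in> \<C>" "x \<in> Z" "y \<in> Z"
        using lin[OF X(1) Y(1)] X Y by (metis subsetD)
      then have "orthonormal Z (\<lambda>b. b)" using sub by (auto simp: \<A>_def)
      then show ?thesis using Z by (simp add: orthonormal_def)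
    qed
    moreover have "A \<subseteq> \<Union>\<C>" using C(1) sub by (force simp: \<A>_def)
    ultimately show "\<Union>\<C> \<in> \<A>" by (simp add: \<A>_def orthonormal_def)
  qed
  then obtain M where M: "A \<subseteq> M" "orthonormal M (\<lambda>b. b)"
      and max: "\<And>X. X \<in> \<A> \<Longrightarrow> M \<subseteq> X \<Longrightarrow> X = M"
    by (auto simp: \<A>_def)
  have "x = 0" if x: "\<forall>b\<in>M. ip x b = 0" for x
  proof (rule ccontr)
    assume "x \<noteq> 0"
    define y where "y = x /\<^sub>R norm x"
    have "norm y = 1" using \<open>x \<noteq> 0\<close> by (simp add: y_def)
    then have y1: "ip y y = 1" by (simp add: ip_self_one_iff)
    have y0: "ip y b = 0" "ip b y = 0" if "b \<in> M" for b
      using x that ip_zero_sym[of x b] by (auto simp: y_def)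
    have "insert y M \<in> \<A>"
      using M y0 y1 by (auto simp: \<A>_def orthonormal_def)
    then have "y \<in> M" using max[of "insert y M"] by auto
    then show False using y0(1)[of y] y1 by simp
  qed
  then show ?thesis using M by (auto simp: onb_def)
qed

text \<open>
  Members of an orthonormal family have mutual distance \<open>sqrt 2\<close>, so different ones cannot be
  within distance \<open>1/2\<close> of the same point of a countable dense set.
\<close>
lemma orthonormal_countable:
  assumes "separable_space (euclidean :: 'h topology)" "orthonormal I e" shows "countable I"
proof -
  obtain D :: "'h set" where D: "countable D" "closure D = UNIV"
    using assms(1) by (auto simp: separable_space_def)
  have "\<exists>d\<in>D. dist d (e i) < 1/2" for i
    using D(2) closure_approachable[of "e i" D] by (metis UNIV_I half_gt_zero zero_less_one)
  then obtain d where d: "\<And>i. d i \<in> D" "\<And>i. dist (d i) (e i) < 1/2" by metis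
  have "inj_on d I"
  proof (rule inj_onI, rule ccontr)
    fix i j assume ij: "i \<in> I" "j \<in> I" "d i = d j" "i \<noteq> j"
    have "ip (e i) (- e j) = 0" using orthonormal_diff[OF assms(2) ij(1,2,4)] by simp
    then have "(norm (e i - e j))\<^sup>2 = 2"
      using norm_add_orth[of "e i" "- e j"] orthonormal_norm[OF assms(2)] ij by simp
    moreover have "norm (e i - e j) < 1"
      using d(2)[of i] d(2)[of j] ij(3) dist_triangle_half_r[of "d i" "e i" 1 "e j"]
      by (simp add: dist_norm)
    then have "(norm (e i - e j))\<^sup>2 < 1" by (simp add: abs_square_less_1)
    ultimately show False by simp
  qed
  moreover have "countable (d ` I)" using D(1) d(1) by (meson countable_subset image_subsetI)
  ultimately show ?thesis using countable_image_inj_on by blast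
qed

lemma onb_infinite:
  assumes "infinite_dimensional smul" "onb I e" shows "infinite I"
proof
  assume fin: "finite I"
  have inj: "inj_on e I" using assms(2) onb_orthonormal orthonormal_inj by blast
  have "\<exists>c. x = (\<Sum>b\<in>e ` I. smul (c b) b)" for x
  proof
    have "x = (\<Sum>i\<in>I. smul (ip x (e i)) (e i))"
      using onb_expansion[OF assms(2)] fin by (simp add: has_sum_finite_iff)
    then show "x = (\<Sum>b\<in>e ` I. smul (ip x b) b)" by (simp add: sum.reindex[OF inj])
  qed
  then show False using assms(1) fin unfolding infinite_dimensional_def by blast
qed


section \<open>Unitary operators\<close>

lemma unitaryI:
  assumes "scalar_linear g" "\<And>x. norm (blinfun_apply g x) = norm x" "surj (blinfun_apply g)"
  shows "g \<in> unitaries smul"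
  using assms by (simp add: unitaries_def scalar_linear_def)

lemma unitary_scalar_linear: "g \<in> unitaries smul \<Longrightarrow> scalar_linear g"
  by (simp add: unitaries_def scalar_linear_def)

lemma unitary_norm: "g \<in> unitaries smul \<Longrightarrow> norm (blinfun_apply g x) = norm x"
  by (simp add: unitaries_def)

lemma unitary_bij: "g \<in> unitaries smul \<Longrightarrow> bij (blinfun_apply g)"
  unfolding bij_def inj_def
  by (auto simp: unitaries_def) (metis blinfun.diff_right norm_eq_zero right_minus_eq)

text \<open>
  Polarization gives the value of \<open>a \<langle>x, y\<rangle>\<close> plus its conjugate from norms, for every scalar \<open>a\<close>.
  The choice of \<open>a\<close> as the conjugate of the difference of two inner products makes the sum
  twice the squared absolute value of the difference.
\<close>
lemma unitary_ip:
  assumes g: "g \<in> unitaries smul" shows "ip (blinfun_apply g x) (blinfun_apply g y) = ip x y"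
proof -
  define z where "z = ip (blinfun_apply g x) (blinfun_apply g y) - ip x y"
  have pol: "(of_real ((norm (x + y))\<^sup>2 - (norm x)\<^sup>2 - (norm y)\<^sup>2) :: 'k) = ip x y + conj (ip x y)" for x y
    by (simp only: of_real_diff ip_self[symmetric] ip_add_left ip_add_right ip_commute[symmetric])
      simp
  have inv: "ip (blinfun_apply g x) (blinfun_apply g y) + conj (ip (blinfun_apply g x) (blinfun_apply g y))
      = ip x y + conj (ip x y)" for x y
    unfolding pol[symmetric] blinfun.add_right[symmetric] using unitary_norm[OF g] by simp
  have "a * z + conj (a * z) = 0" for a
  proof -
    let ?p = "a * ip (blinfun_apply g x) (blinfun_apply g y)" and ?q = "a * ip x y"
    have "?p + conj ?p = ?q + conj ?q"
      using inv[of "smul a x" y] unitary_scalar_linear[OF g]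
      by (simp add: scalar_linear_def ip_smul_left)
    moreover have "conj ?p = conj (a * z) + conj ?q"
      unfolding z_def conj_add[symmetric] by (simp add: algebra_simps)
    ultimately show ?thesis by (simp add: z_def algebra_simps)
  qed
  from this[of "conj z"] have "(of_real (nsq (conj z) + nsq (conj z)) :: 'k) = of_real 0"
    using mult_conj[of "conj z"] by (simp only: conj_conj conj_of_real of_real_add of_real_0)
  then have "conj z = 0" unfolding of_real_eq_iff by (simp add: nsq_eq_zero_iff)
  then have "z = 0" by (metis conj_conj conj_zero)
  then show ?thesis by (simp add: z_def)
qed

lemma unitary_id: "id_blinfun \<in> unitaries smul"
  by (auto intro!: unitaryI simp: scalar_linear_def)

lemma unitary_compose:
  assumes "g \<in> unitaries smul" "h \<in> unitaries smul" shows "g o\<^sub>L h \<in> unitaries smul"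
proof (rule unitaryI)
  have "bij (blinfun_apply g \<circ> blinfun_apply h)"
    using assms unitary_bij bij_comp by blast
  moreover have "blinfun_apply (g o\<^sub>L h) = blinfun_apply g \<circ> blinfun_apply h" by auto
  ultimately show "surj (blinfun_apply (g o\<^sub>L h))" by (metis bij_is_surj)
qed (use assms in \<open>auto simp: unitary_norm scalar_linear_def dest!: unitary_scalar_linear\<close>)

definition uinv :: "('h \<Rightarrow>\<^sub>L 'h) \<Rightarrow> ('h \<Rightarrow>\<^sub>L 'h)" where
  "uinv g = Blinfun (inv_into UNIV (blinfun_apply g))"

lemma
  assumes g: "g \<in> unitaries smul"
  shows uinv_right [simp]: "blinfun_apply g (blinfun_apply (uinv g) x) = x"
    and uinv_left [simp]: "blinfun_apply (uinv g) (blinfun_apply g x) = x"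
    and uinv_unitary [simp]: "uinv g \<in> unitaries smul"
proof -
  let ?g = "blinfun_apply g" and ?h = "inv_into UNIV (blinfun_apply g)"
  have r: "?g (?h x) = x" for x using unitary_bij[OF g] by (simp add: surj_f_inv_f bij_is_surj)
  have l: "?h (?g x) = x" for x using unitary_bij[OF g] by (simp add: inv_f_f bij_is_inj)
  have "bounded_linear ?h"
  proof
    show "?h (x + y) = ?h x + ?h y" for x y by (metis blinfun.add_right l r)
    show "?h (s *\<^sub>R x) = s *\<^sub>R ?h x" for s x by (metis blinfun.scaleR_right l r)
    show "\<exists>K. \<forall>x. norm (?h x) \<le> norm x * K"
      by (rule exI[of _ 1]) (metis unitary_norm[OF g] mult.right_neutral order_refl r)
  qed
  then have a: "blinfun_apply (uinv g) = ?h" by (simp add: uinv_def bounded_linear_Blinfun_apply)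
  show "blinfun_apply g (blinfun_apply (uinv g) x) = x" "blinfun_apply (uinv g) (blinfun_apply g x) = x"
    by (simp_all add: a r l)
  show "uinv g \<in> unitaries smul"
  proof (rule unitaryI)
    show "scalar_linear (uinv g)"
      using unitary_scalar_linear[OF g] unfolding scalar_linear_def a by (metis l r)
    show "norm (blinfun_apply (uinv g) x) = norm x" for x
      using unitary_norm[OF g] unfolding a by (metis r)
    show "surj (blinfun_apply (uinv g))" unfolding a by (metis l surjI)
  qed
qed

lemma uinv_compose_left: "g \<in> unitaries smul \<Longrightarrow> uinv g o\<^sub>L g = id_blinfun"
  by (auto intro!: blinfun_eqI)

lemma ip_uinv: "g \<in> unitaries smul \<Longrightarrow> ip (blinfun_apply (uinv g) x) y = ip x (blinfun_apply g y)"
  using unitary_ip[of g "blinfun_apply (uinv g) x" y] by simp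

lemma orthonormal_unitary:
  assumes "orthonormal I e" "g \<in> unitaries smul" shows "orthonormal I (\<lambda>i. blinfun_apply g (e i))"
  using assms by (simp add: orthonormal_def unitary_ip)

lemma group_unitary_group: "group (unitary_group smul)"
proof (rule groupI)
  fix g assume "g \<in> carrier (unitary_group smul)"
  then show "\<exists>h\<in>carrier (unitary_group smul). h \<otimes>\<^bsub>unitary_group smul\<^esub> g = \<one>\<^bsub>unitary_group smul\<^esub>"
    by (auto simp: unitary_group_def uinv_compose_left intro: bexI[of _ "uinv g"])
qed (auto simp: unitary_group_def unitary_compose unitary_id blinfun_eqI)

lemma inv_unitary_group:
  assumes "g \<in> unitaries smul" shows "inv\<^bsub>unitary_group smul\<^esub> g = uinv g"
  by (rule group.inv_equality[OF group_unitary_group])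
    (use assms in \<open>simp_all add: unitary_group_def uinv_compose_left\<close>)

text \<open>The operator transports the coefficients of the expansion.\<close>
lemma onb_unitary:
  assumes e: "onb I e" and f: "onb I f"
  shows "\<exists>g\<in>unitaries smul. \<forall>i\<in>I. blinfun_apply g (e i) = f i"
proof -
  define G where "G = (\<lambda>x. infsum (\<lambda>i. smul (ip x (e i)) (f i)) I)"
  have eo: "orthonormal I e" and fo: "orthonormal I f" using e f onb_orthonormal by auto
  have ex: "\<exists>s. ((\<lambda>i. smul (ip x (e i)) (f i)) has_sum s) I \<and> (\<forall>j\<in>I. ip s (f j) = ip x (e j))" for x
    by (rule riesz_fischer[OF fo, where M = "(norm x)\<^sup>2"]) (rule bessel[OF eo])
  have sums: "((\<lambda>i. smul (ip x (e i)) (f i)) has_sum G x) I"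
    and coeff: "\<And>j. j \<in> I \<Longrightarrow> ip (G x) (f j) = ip x (e j)" for x
    using ex[of x] unfolding G_def by (auto simp: infsumI)
  have char: "G x = y" if "\<And>j. j \<in> I \<Longrightarrow> ip y (f j) = ip x (e j)" for x y
    using onb_total[OF f, of "G x - y"] that by (simp add: ip_diff_left coeff)
  have norm: "norm (G x) = norm x" for x
  proof -
    have "((\<lambda>F. norm (\<Sum>i\<in>F. smul (ip x (e i)) (f i))) \<longlongrightarrow> norm (G x)) (finite_subsets_at_top I)"
      using sums[of x] unfolding has_sum_def by (rule tendsto_norm)
    moreover have "((\<lambda>F. norm (\<Sum>i\<in>F. smul (ip x (e i)) (e i))) \<longlongrightarrow> norm x) (finite_subsets_at_top I)"
      using onb_expansion[OF e, of x] unfolding has_sum_def by (rule tendsto_norm)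
    moreover have "\<forall>\<^sub>F F in finite_subsets_at_top I. norm (\<Sum>i\<in>F. smul (ip x (e i)) (f i))
        = norm (\<Sum>i\<in>F. smul (ip x (e i)) (e i))"
    proof (rule eventually_finite_subsets_at_top_weakI)
      fix F assume "finite F" "F \<subseteq> I"
      then have "(norm (\<Sum>i\<in>F. smul (ip x (e i)) (f i)))\<^sup>2 = (norm (\<Sum>i\<in>F. smul (ip x (e i)) (e i)))\<^sup>2"
        by (simp only: norm_sum_orthonormal[OF eo] norm_sum_orthonormal[OF fo])
      then show "norm (\<Sum>i\<in>F. smul (ip x (e i)) (f i)) = norm (\<Sum>i\<in>F. smul (ip x (e i)) (e i))"
        by simp
    qed
    ultimately have "((\<lambda>F. norm (\<Sum>i\<in>F. smul (ip x (e i)) (f i))) \<longlongrightarrow> norm x) (finite_subsets_at_top I)"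
      and lim: "((\<lambda>F. norm (\<Sum>i\<in>F. smul (ip x (e i)) (f i))) \<longlongrightarrow> norm (G x)) (finite_subsets_at_top I)"
      by (simp_all add: tendsto_cong)
    then show ?thesis
      by (intro tendsto_unique[OF finite_subsets_at_top_neq_bot lim])
  qed
  have smul: "G (smul a x) = smul a (G x)" for a x
    by (rule char) (simp add: coeff ip_smul_left)
  have "bounded_linear G"
  proof
    show "G (x + y) = G x + G y" for x y by (rule char) (simp add: coeff ip_add_left)
    show "G (r *\<^sub>R x) = r *\<^sub>R G x" for r x by (rule char) (simp add: coeff)
    show "\<exists>K. \<forall>x. norm (G x) \<le> norm x * K" by (rule exI[of _ 1]) (simp add: norm)
  qed
  then have app: "blinfun_apply (Blinfun G) = G" by (rule bounded_linear_Blinfun_apply)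
  have "\<exists>x. y = G x" for y
  proof -
    from riesz_fischer[OF eo, of "\<lambda>i. ip y (f i)" "(norm y)\<^sup>2"]
    obtain x where "\<And>j. j \<in> I \<Longrightarrow> ip x (e j) = ip y (f j)" using bessel[OF fo] by blast
    then have "G x = y" by (intro char) simp
    then show ?thesis by blast
  qed
  then have "surj G" unfolding surj_def by blast
  then have "Blinfun G \<in> unitaries smul"
    by (auto intro!: unitaryI simp: app scalar_linear_def norm smul)
  moreover have "G (e i) = f i" if "i \<in> I" for i
    by (rule char) (use eo fo that in \<open>simp add: orthonormal_def\<close>)
  ultimately show ?thesis using app by (metis)
qed

end


section \<open>The identity component of the unitaries that are compact perturbations of the identity\<close>

lemma compact_operatorI:
  assumes "\<And>S. bounded S \<Longrightarrow> \<exists>K. compact K \<and> blinfun_apply T ` S \<subseteq> K"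
  shows "compact_operator T"
  unfolding compact_operator_def
proof (intro allI impI)
  fix S :: "'a set" assume "bounded S"
  then obtain K where K: "compact K" "blinfun_apply T ` S \<subseteq> K" using assms by blast
  then have "K \<inter> closure (blinfun_apply T ` S) = closure (blinfun_apply T ` S)"
    using closure_minimal[OF K(2) compact_imp_closed] by auto
  then show "compact (closure (blinfun_apply T ` S))"
    using compact_Int_closed[OF K(1) closed_closure] by metis
qed

lemma compact_operatorE:
  assumes "compact_operator T" "bounded S"
  obtains K where "compact K" "blinfun_apply T ` S \<subseteq> K"
  using assms closure_subset unfolding compact_operator_def by metis

lemma compact_operator_add:
  assumes "compact_operator S" "compact_operator T" shows "compact_operator (S + T)"
proof (rule compact_operatorI)
  fix B :: "'a set" assume B: "bounded B"
  obtain K where K: "compact K" "blinfun_apply S ` B \<subseteq> K" using compact_operatorE[OF assms(1) B] .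
  obtain L where L: "compact L" "blinfun_apply T ` B \<subseteq> L" using compact_operatorE[OF assms(2) B] .
  have "blinfun_apply (S + T) ` B \<subseteq> {x + y | x y. x \<in> K \<and> y \<in> L}"
    using K(2) L(2) by (force simp: blinfun.add_left)
  then show "\<exists>K. compact K \<and> blinfun_apply (S + T) ` B \<subseteq> K"
    using compact_sums[OF K(1) L(1)] by blast
qed

lemma compact_operator_compose_left:
  assumes "compact_operator T" shows "compact_operator (A o\<^sub>L T)"
proof (rule compact_operatorI)
  fix B :: "'a set" assume B: "bounded B"
  obtain K where K: "compact K" "blinfun_apply T ` B \<subseteq> K" using compact_operatorE[OF assms B] .
  have "compact (blinfun_apply A ` K)"
    by (intro compact_continuous_image K(1) continuous_intros)
  moreover have "blinfun_apply (A o\<^sub>L T) ` B \<subseteq> blinfun_apply A ` K" using K(2) by auto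
  ultimately show "\<exists>K. compact K \<and> blinfun_apply (A o\<^sub>L T) ` B \<subseteq> K" by blast
qed

lemma compact_operator_compose_right:
  fixes T :: "'a::real_normed_vector \<Rightarrow>\<^sub>L 'b::real_normed_vector"
    and A :: "'c::real_normed_vector \<Rightarrow>\<^sub>L 'a"
  assumes "compact_operator T" shows "compact_operator (T o\<^sub>L A)"
proof (rule compact_operatorI)
  fix B :: "'c set" assume B: "bounded B"
  have "bounded (blinfun_apply A ` B)"
    by (rule bounded_linear_image[OF B blinfun.bounded_linear_right])
  then obtain K where "compact K" "blinfun_apply T ` (blinfun_apply A ` B) \<subseteq> K"
    using compact_operatorE[OF assms] by blast
  then show "\<exists>K. compact K \<and> blinfun_apply (T o\<^sub>L A) ` B \<subseteq> K" by (auto simp: image_image)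
qed

lemma compact_operator_zero: "compact_operator 0"
  by (rule compact_operatorI) (auto intro!: exI[of _ "{0}"])

text \<open>
  By induction, the set is a sum of compact segments.
\<close>
lemma compact_box:
  fixes y :: "'i \<Rightarrow> 'a::real_normed_vector"
  assumes "finite F" shows "compact {\<Sum>i\<in>F. t i *\<^sub>R y i | t. \<forall>i\<in>F. \<bar>t i\<bar> \<le> c}"
  using assms
proof (induction F rule: finite_induct)
  case (insert j F)
  let ?K = "\<lambda>F. {\<Sum>i\<in>F. t i *\<^sub>R y i | t. \<forall>i\<in>F. \<bar>t i\<bar> \<le> c}"
  have "compact ((\<lambda>s. s *\<^sub>R y j) ` {-c..c})"
    by (intro compact_continuous_image continuous_intros) simp
  then have comp: "compact {a + b | a b. a \<in> (\<lambda>s. s *\<^sub>R y j) ` {-c..c} \<and> b \<in> ?K F}"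
    using insert.IH by (rule compact_sums)
  have "?K (insert j F) = {a + b | a b. a \<in> (\<lambda>s. s *\<^sub>R y j) ` {-c..c} \<and> b \<in> ?K F}"
  proof (rule equalityI; rule subsetI)
    fix x assume "x \<in> ?K (insert j F)"
    then obtain t where t: "x = (\<Sum>i\<in>insert j F. t i *\<^sub>R y i)" "\<forall>i\<in>insert j F. \<bar>t i\<bar> \<le> c" by blast
    have "x = t j *\<^sub>R y j + (\<Sum>i\<in>F. t i *\<^sub>R y i)" using t(1) insert.hyps by simp
    moreover have "t j *\<^sub>R y j \<in> (\<lambda>s. s *\<^sub>R y j) ` {-c..c}" using t(2) by (auto simp: abs_le_iff)
    moreover have "(\<Sum>i\<in>F. t i *\<^sub>R y i) \<in> ?K F" using t(2) by blast
    ultimately show "x \<in> {a + b | a b. a \<in> (\<lambda>s. s *\<^sub>R y j) ` {-c..c} \<and> b \<in> ?K F}" by blast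
  next
    fix x assume "x \<in> {a + b | a b. a \<in> (\<lambda>s. s *\<^sub>R y j) ` {-c..c} \<and> b \<in> ?K F}"
    then obtain s t where st: "s \<in> {-c..c}" "\<forall>i\<in>F. \<bar>t i\<bar> \<le> c"
        "x = s *\<^sub>R y j + (\<Sum>i\<in>F. t i *\<^sub>R y i)" by blast
    have "(\<Sum>i\<in>F. t i *\<^sub>R y i) = (\<Sum>i\<in>F. (t(j := s)) i *\<^sub>R y i)"
      by (rule sum.cong) (use insert.hyps in auto)
    then have "x = (\<Sum>i\<in>insert j F. (t(j := s)) i *\<^sub>R y i)"
      using st(3) insert.hyps by simp
    moreover have "\<forall>i\<in>insert j F. \<bar>(t(j := s)) i\<bar> \<le> c" using st by (auto simp: abs_le_iff)
    ultimately show "x \<in> ?K (insert j F)" by blast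
  qed
  then show ?case using comp by simp
qed simp

context conj_hilbert_space begin

text \<open>The finite dimension of the scalars turns scalar multiples into boxes of real combinations.\<close>
lemma compact_operator_finite_rank:
  fixes T :: "'h \<Rightarrow>\<^sub>L 'h"
  assumes "finite F" "\<And>x. blinfun_apply T x = (\<Sum>i\<in>F. smul (c x i) (y i))"
    "\<And>x i. i \<in> F \<Longrightarrow> nsq (c x i) \<le> M * (norm x)\<^sup>2"
  shows "compact_operator T"
proof (rule compact_operatorI)
  fix S :: "'h set" assume "bounded S"
  then obtain b where b: "\<And>x. x \<in> S \<Longrightarrow> norm x \<le> b" by (auto simp: bounded_iff)
  obtain L where L: "finite L"
      "\<And>a. \<exists>t. a = (\<Sum>l\<in>L. t l *\<^sub>R l) \<and> (\<forall>l\<in>L. (t l)\<^sup>2 \<le> nsq a)"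
    using scalars_finite_dim by blast
  then obtain t where t: "\<And>a. a = (\<Sum>l\<in>L. t a l *\<^sub>R l)" "\<And>a l. l \<in> L \<Longrightarrow> (t a l)\<^sup>2 \<le> nsq a"
    by metis
  define d where "d = sqrt (\<bar>M\<bar> * b\<^sup>2)"
  let ?K = "{\<Sum>p\<in>F \<times> L. s p *\<^sub>R smul (snd p) (y (fst p)) | s. \<forall>p\<in>F \<times> L. \<bar>s p\<bar> \<le> d}"
  have "blinfun_apply T ` S \<subseteq> ?K"
  proof (rule image_subsetI)
    fix x assume "x \<in> S"
    define s where "s = (\<lambda>p. t (c x (fst p)) (snd p))"
    have "blinfun_apply T x = (\<Sum>i\<in>F. \<Sum>l\<in>L. t (c x i) l *\<^sub>R smul l (y i))"
      unfolding assms(2)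
      by (subst t(1)) (simp add: smul_sum_left smul_scaleR_left)
    also have "\<dots> = (\<Sum>p\<in>F \<times> L. s p *\<^sub>R smul (snd p) (y (fst p)))"
      by (simp add: sum.cartesian_product s_def case_prod_beta)
    finally have eq: "blinfun_apply T x = (\<Sum>p\<in>F \<times> L. s p *\<^sub>R smul (snd p) (y (fst p)))" .
    have "\<bar>s p\<bar> \<le> d" if "p \<in> F \<times> L" for p
    proof -
      have "(s p)\<^sup>2 \<le> nsq (c x (fst p))" using t(2) that by (auto simp: s_def)
      also have "\<dots> \<le> M * (norm x)\<^sup>2" using assms(3) that by auto
      also have "\<dots> \<le> \<bar>M\<bar> * b\<^sup>2"
        using b[OF \<open>x \<in> S\<close>] by (intro mult_mono power_mono) auto
      finally show ?thesis unfolding d_def by (rule real_le_rsqrt[of "\<bar>s p\<bar>", simplified])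
    qed
    then show "blinfun_apply T x \<in> ?K" using eq by blast
  qed
  moreover have "compact ?K" using assms(1) L(1) by (intro compact_box) simp
  ultimately show "\<exists>K. compact K \<and> blinfun_apply T ` S \<subseteq> K" by blast
qed

lemma unitaries_compact_id: "id_blinfun \<in> unitaries_compact smul"
  by (simp add: unitaries_compact_def unitary_id compact_operator_zero)

lemma unitaries_compact_unitary: "g \<in> unitaries_compact smul \<Longrightarrow> g \<in> unitaries smul"
  by (simp add: unitaries_compact_def)

lemma unitaries_compact_compose:
  assumes "g \<in> unitaries_compact smul" "h \<in> unitaries_compact smul"
  shows "g o\<^sub>L h \<in> unitaries_compact smul"
proof -
  have eq: "(g o\<^sub>L h) - id_blinfun = ((g - id_blinfun) o\<^sub>L h) + (h - id_blinfun)"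
    by (rule blinfun_eqI) (simp add: blinfun.bilinear_simps)
  have "compact_operator ((g o\<^sub>L h) - id_blinfun)"
    unfolding eq using assms
    by (intro compact_operator_add compact_operator_compose_right)
      (simp_all add: unitaries_compact_def)
  then show ?thesis using assms by (simp add: unitaries_compact_def unitary_compose)
qed

lemma unitaries_compact_uinv:
  assumes "g \<in> unitaries_compact smul" shows "uinv g \<in> unitaries_compact smul"
proof -
  have "uinv g - id_blinfun = - uinv g o\<^sub>L (g - id_blinfun)"
    by (rule blinfun_eqI)
      (simp add: blinfun.bilinear_simps uinv_left[OF unitaries_compact_unitary[OF assms]])
  then show ?thesis
    using assms by (simp add: unitaries_compact_def compact_operator_compose_left)
qed

lemma unitaries_compact_conjugate:
  assumes "g \<in> unitaries_compact smul" "p \<in> unitaries smul"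
  shows "p o\<^sub>L g o\<^sub>L uinv p \<in> unitaries_compact smul"
proof -
  have "(p o\<^sub>L g o\<^sub>L uinv p) - id_blinfun = p o\<^sub>L (g - id_blinfun) o\<^sub>L uinv p"
    by (rule blinfun_eqI) (use assms in \<open>simp add: blinfun.bilinear_simps\<close>)
  then show ?thesis
    using assms by (simp add: unitaries_compact_def unitary_compose compact_operator_compose_left
        compact_operator_compose_right)
qed

lemma unitaries_compact_0_subset: "unitaries_compact_0 smul \<subseteq> unitaries_compact smul"
  by (simp add: unitaries_compact_0_def connected_component_subset)

lemma unitaries_compact_0I:
  assumes "connected T" "T \<subseteq> unitaries_compact smul" "g \<in> T" "h \<in> T" "h \<in> unitaries_compact_0 smul"
  shows "g \<in> unitaries_compact_0 smul"
proof -
  have "T \<subseteq> connected_component_set (unitaries_compact smul) h"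
    by (rule connected_component_maximal) (use assms in auto)
  also have "\<dots> = unitaries_compact_0 smul"
    using assms(5) unfolding unitaries_compact_0_def by (metis connected_component_eq)
  finally show ?thesis using assms by blast
qed

lemma unitaries_compact_0_id: "id_blinfun \<in> unitaries_compact_0 smul"
  unfolding unitaries_compact_0_def using unitaries_compact_id by (simp add: connected_component_refl)

lemma connected_unitaries_compact_0: "connected (unitaries_compact_0 smul)"
  by (simp add: unitaries_compact_0_def)

lemma continuous_on_blinfun_compose' [continuous_intros]:
  fixes f :: "'x::topological_space \<Rightarrow> 'h \<Rightarrow>\<^sub>L 'h"
  shows "continuous_on S f \<Longrightarrow> continuous_on S g \<Longrightarrow> continuous_on S (\<lambda>x. f x o\<^sub>L g x)"
  by (rule bounded_bilinear.continuous_on[OF bounded_bilinear_blinfun_compose])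

text \<open>
  Translations and conjugations are continuous, so they map the connected identity component into
  a component of \<open>unitaries_compact\<close>, which is recognized from one common point.
\<close>
lemma unitaries_compact_0_normal: "unitaries_compact_0 smul \<lhd> unitary_group smul"
proof -
  let ?C = "unitaries_compact_0 smul"
  interpret group "unitary_group smul" by (rule group_unitary_group)
  have carrier: "carrier (unitary_group smul) = unitaries smul" by (simp add: unitary_group_def)
  have C: "g \<in> unitaries_compact smul" if "g \<in> ?C" for g
    using that unitaries_compact_0_subset by blast
  then have CU: "g \<in> unitaries smul" if "g \<in> ?C" for g
    using that unitaries_compact_unitary by blast
  have comp: "g o\<^sub>L h \<in> ?C" if "g \<in> ?C" "h \<in> ?C" for g h
  proof (rule unitaries_compact_0I)
    show "connected ((\<lambda>h. g o\<^sub>L h) ` ?C)"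
      by (intro connected_continuous_image connected_unitaries_compact_0 continuous_intros)
    show "(\<lambda>h. g o\<^sub>L h) ` ?C \<subseteq> unitaries_compact smul"
      using C that by (auto intro: unitaries_compact_compose)
    show "g o\<^sub>L h \<in> (\<lambda>h. g o\<^sub>L h) ` ?C" using that by blast
    show "g \<in> (\<lambda>h. g o\<^sub>L h) ` ?C"
      by (rule image_eqI[of _ _ id_blinfun]) (auto simp: unitaries_compact_0_id intro: blinfun_eqI)
  qed fact
  have inv: "uinv g \<in> ?C" if "g \<in> ?C" for g
  proof (rule unitaries_compact_0I)
    show "connected ((\<lambda>h. uinv g o\<^sub>L h) ` ?C)"
      by (intro connected_continuous_image connected_unitaries_compact_0 continuous_intros)
    show "(\<lambda>h. uinv g o\<^sub>L h) ` ?C \<subseteq> unitaries_compact smul"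
      using C that by (auto intro: unitaries_compact_compose unitaries_compact_uinv)
    show "id_blinfun \<in> (\<lambda>h. uinv g o\<^sub>L h) ` ?C"
      by (rule image_eqI[of _ _ g]) (auto simp: uinv_compose_left CU that)
    show "uinv g \<in> (\<lambda>h. uinv g o\<^sub>L h) ` ?C"
      by (rule image_eqI[of _ _ id_blinfun]) (auto simp: unitaries_compact_0_id intro: blinfun_eqI)
  qed (rule unitaries_compact_0_id)
  have conj: "p o\<^sub>L g o\<^sub>L uinv p \<in> ?C" if "g \<in> ?C" "p \<in> unitaries smul" for g p
  proof (rule unitaries_compact_0I)
    show "connected ((\<lambda>h. p o\<^sub>L h o\<^sub>L uinv p) ` ?C)"
      by (intro connected_continuous_image connected_unitaries_compact_0 continuous_intros)
    show "(\<lambda>h. p o\<^sub>L h o\<^sub>L uinv p) ` ?C \<subseteq> unitaries_compact smul"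
      using C that by (auto intro: unitaries_compact_conjugate)
    show "id_blinfun \<in> (\<lambda>h. p o\<^sub>L h o\<^sub>L uinv p) ` ?C"
      by (rule image_eqI[of _ _ id_blinfun])
        (auto simp: unitaries_compact_0_id that intro!: blinfun_eqI)
    show "p o\<^sub>L g o\<^sub>L uinv p \<in> (\<lambda>h. p o\<^sub>L h o\<^sub>L uinv p) ` ?C" using that by blast
  qed (rule unitaries_compact_0_id)
  show ?thesis
  proof (rule normal_invI)
    show "subgroup ?C (unitary_group smul)"
    proof (rule subgroupI)
      show "?C \<subseteq> carrier (unitary_group smul)" using CU carrier by blast
      show "?C \<noteq> {}" using unitaries_compact_0_id by blast
    qed (use inv comp CU in \<open>auto simp: inv_unitary_group\<close>, simp add: unitary_group_def)
    fix p g assume "p \<in> carrier (unitary_group smul)" "g \<in> ?C"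
    then show "p \<otimes>\<^bsub>unitary_group smul\<^esub> g \<otimes>\<^bsub>unitary_group smul\<^esub> inv\<^bsub>unitary_group smul\<^esub> p \<in> ?C"
      using conj[of g p] by (simp add: carrier inv_unitary_group) (simp add: unitary_group_def)
  qed
qed

end


section \<open>Rotations in a sequence of orthogonal planes\<close>

context conj_hilbert_space begin

text \<open>
  The quarter turn and the reflections below send a basis to families of this form.
\<close>
lemma onb_signed_reindex:
  assumes "onb I e" "bij_betw \<sigma> I I" "\<And>i. i \<in> I \<Longrightarrow> s i = 1 \<or> s i = (-1 :: real)"
  shows "onb I (\<lambda>i. s i *\<^sub>R e (\<sigma> i))"
proof -
  have onb: "onb I (\<lambda>i. e (\<sigma> i))" by (rule onb_reindex[OF assms(1,2)])
  have s: "s i * s i = 1" "s i \<noteq> 0" if "i \<in> I" for i using assms(3)[OF that] by auto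
  have "orthonormal I (\<lambda>i. s i *\<^sub>R e (\<sigma> i))"
    using onb_orthonormal[OF onb] s by (simp add: orthonormal_def)
  then show ?thesis using onb s by (auto simp: onb_def)
qed

lemma scalar_linear_intros:
  "scalar_linear id_blinfun"
  "scalar_linear S \<Longrightarrow> scalar_linear T \<Longrightarrow> scalar_linear (S + T)"
  "scalar_linear S \<Longrightarrow> scalar_linear T \<Longrightarrow> scalar_linear (S - T)"
  "scalar_linear S \<Longrightarrow> scalar_linear (r *\<^sub>R S)"
  "scalar_linear S \<Longrightarrow> scalar_linear T \<Longrightarrow> scalar_linear (S o\<^sub>L T)"
  by (simp_all add: scalar_linear_def blinfun.bilinear_simps smul_add_right smul_diff_right smul_scaleR)

end

locale plane_sequence = conj_hilbert_space conj smul ip nsq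
  for conj :: "'k::real_algebra_1 \<Rightarrow> 'k" and smul :: "'k \<Rightarrow> 'h::banach \<Rightarrow> 'h"
    and ip :: "'h \<Rightarrow> 'h \<Rightarrow> 'k" and nsq :: "'k \<Rightarrow> real" +
  fixes e :: "nat \<times> bool \<Rightarrow> 'h"
  assumes onb_e: "onb UNIV e"
begin

lemma eqI:
  assumes "scalar_linear S" "scalar_linear T" "\<And>n b. blinfun_apply S (e (n, b)) = blinfun_apply T (e (n, b))"
  shows "S = T"
  by (rule scalar_linear_eqI[OF onb_e assms(1,2)]) (use assms(3) in auto)

definition quarter_turn :: "'h \<Rightarrow>\<^sub>L 'h" where
  "quarter_turn = (SOME g. g \<in> unitaries smul \<and>
     (\<forall>n b. blinfun_apply g (e (n, b)) = (if b then -1 else 1) *\<^sub>R e (n, \<not> b)))"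

definition reflection :: "nat set \<Rightarrow> ('h \<Rightarrow>\<^sub>L 'h)" where
  "reflection A = (SOME g. g \<in> unitaries smul \<and>
     (\<forall>n b. blinfun_apply g (e (n, b)) = (if n \<in> A then -1 else 1) *\<^sub>R e (n, b)))"

definition plane_projection :: "nat set \<Rightarrow> ('h \<Rightarrow>\<^sub>L 'h)" where
  "plane_projection A = (1/2) *\<^sub>R (id_blinfun - reflection A)"

text \<open>
  Writing the rotation as a perturbation of the identity bounds its distance from the identity
  independently of \<open>A\<close> and shows that it has finite rank up to the identity for finite \<open>A\<close>.
\<close>
definition rotation :: "nat set \<Rightarrow> real \<Rightarrow> ('h \<Rightarrow>\<^sub>L 'h)" where
  "rotation A t = id_blinfun +
     (plane_projection A o\<^sub>L ((cos t - 1) *\<^sub>R id_blinfun + sin t *\<^sub>R quarter_turn))"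

lemma quarter_turn:
  shows quarter_turn_unitary: "quarter_turn \<in> unitaries smul"
    and quarter_turn_e: "blinfun_apply quarter_turn (e (n, b)) = (if b then -1 else 1) *\<^sub>R e (n, \<not> b)"
proof -
  have "bij (\<lambda>p :: nat \<times> bool. (fst p, \<not> snd p))"
    by (rule involuntory_imp_bij) simp
  then have "onb UNIV (\<lambda>p. (if snd p then -1 else 1) *\<^sub>R e (fst p, \<not> snd p))"
    by (intro onb_signed_reindex[OF onb_e]) auto
  from onb_unitary[OF onb_e this]
  have "\<exists>g. g \<in> unitaries smul \<and>
      (\<forall>n b. blinfun_apply g (e (n, b)) = (if b then -1 else 1) *\<^sub>R e (n, \<not> b))" by fastforce
  from someI_ex[OF this] show "quarter_turn \<in> unitaries smul"
      "blinfun_apply quarter_turn (e (n, b)) = (if b then -1 else 1) *\<^sub>R e (n, \<not> b)"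
    unfolding quarter_turn_def[symmetric] by blast+
qed

lemma reflection:
  shows reflection_unitary: "reflection A \<in> unitaries smul"
    and reflection_e: "blinfun_apply (reflection A) (e (n, b)) = (if n \<in> A then -1 else 1) *\<^sub>R e (n, b)"
proof -
  have "onb UNIV (\<lambda>p. (if fst p \<in> A then -1 else 1) *\<^sub>R e p)"
    by (intro onb_signed_reindex[OF onb_e, of "\<lambda>p. p"]) (auto simp: bij_def)
  from onb_unitary[OF onb_e this]
  have "\<exists>g. g \<in> unitaries smul \<and>
      (\<forall>n b. blinfun_apply g (e (n, b)) = (if n \<in> A then -1 else 1) *\<^sub>R e (n, b))" by fastforce
  from someI_ex[OF this] show "reflection A \<in> unitaries smul"
      "blinfun_apply (reflection A) (e (n, b)) = (if n \<in> A then -1 else 1) *\<^sub>R e (n, b)"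
    unfolding reflection_def[symmetric] by blast+
qed

lemma scalar_linear_pieces:
  "scalar_linear quarter_turn" "scalar_linear (reflection A)"
  "scalar_linear (plane_projection A)" "scalar_linear (rotation A t)"
  unfolding rotation_def plane_projection_def
  by (intro scalar_linear_intros unitary_scalar_linear quarter_turn_unitary reflection_unitary)+

lemma plane_projection_e:
  "blinfun_apply (plane_projection A) (e (n, b)) = (if n \<in> A then e (n, b) else 0)"
  by (simp add: plane_projection_def blinfun.bilinear_simps reflection_e scaleR_2[symmetric])

lemma rotation_e:
  "blinfun_apply (rotation A t) (e (n, b)) = (if n \<in> A
     then cos t *\<^sub>R e (n, b) + ((if b then -1 else 1) * sin t) *\<^sub>R e (n, \<not> b) else e (n, b))"
  by (simp add: rotation_def blinfun.bilinear_simps quarter_turn_e plane_projection_e scaleR_diff_left)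

lemma quarter_turn_square: "quarter_turn o\<^sub>L quarter_turn = (-1) *\<^sub>R id_blinfun"
  by (intro eqI scalar_linear_intros scalar_linear_pieces)
    (simp add: quarter_turn_e blinfun.bilinear_simps)

lemma reflection_square: "reflection A o\<^sub>L reflection A = id_blinfun"
  by (intro eqI scalar_linear_intros scalar_linear_pieces)
    (simp add: reflection_e blinfun.bilinear_simps)

lemma plane_projection_quarter_turn:
  "plane_projection A o\<^sub>L quarter_turn = quarter_turn o\<^sub>L plane_projection A"
  by (intro eqI scalar_linear_intros scalar_linear_pieces)
    (simp add: quarter_turn_e plane_projection_e blinfun.bilinear_simps)

lemma rotation_zero: "rotation A 0 = id_blinfun"
  by (rule blinfun_eqI) (simp add: rotation_def blinfun.bilinear_simps)

lemma rotation_add: "rotation A s o\<^sub>L rotation A t = rotation A (s + t)"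
proof (intro eqI scalar_linear_intros scalar_linear_pieces)
  fix n b
  show "blinfun_apply (rotation A s o\<^sub>L rotation A t) (e (n, b)) = blinfun_apply (rotation A (s + t)) (e (n, b))"
    by (cases b; simp add: rotation_e blinfun.bilinear_simps cos_add sin_add algebra_simps)
qed

lemma rotation_disjoint:
  assumes "A \<inter> B = {}" shows "rotation A t o\<^sub>L rotation B t = rotation (A \<union> B) t"
proof (intro eqI scalar_linear_intros scalar_linear_pieces)
  fix n b
  show "blinfun_apply (rotation A t o\<^sub>L rotation B t) (e (n, b)) = blinfun_apply (rotation (A \<union> B) t) (e (n, b))"
    using assms by (cases "n \<in> B"; cases b; auto simp: rotation_e blinfun.bilinear_simps)
qed

lemma ip_plane_projection:
  "ip (blinfun_apply (plane_projection A) x) y = ip x (blinfun_apply (plane_projection A) y)"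
proof -
  have "ip (blinfun_apply (reflection A) x) y = ip x (blinfun_apply (reflection A) y)"
    using unitary_ip[OF reflection_unitary, of A x "blinfun_apply (reflection A) y"]
      arg_cong[OF reflection_square, of "\<lambda>T. blinfun_apply T y"] by simp
  then show ?thesis
    by (simp add: plane_projection_def blinfun.bilinear_simps ip_diff_left ip_diff_right)
qed

lemma ip_quarter_turn: "ip (blinfun_apply quarter_turn x) y = - ip x (blinfun_apply quarter_turn y)"
  using unitary_ip[OF quarter_turn_unitary, of x "blinfun_apply quarter_turn y"]
    arg_cong[OF quarter_turn_square, of "\<lambda>T. blinfun_apply T y"]
  by (simp add: blinfun.bilinear_simps) (metis minus_minus)

text \<open>
  The adjoint of a rotation is the inverse rotation, because the projection is self-adjoint, the
  quarter turn is skew-adjoint and the two commute.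
\<close>
lemma ip_rotation: "ip (blinfun_apply (rotation A t) x) y = ip x (blinfun_apply (rotation A (- t)) y)"
proof -
  have "blinfun_apply (plane_projection A) (blinfun_apply quarter_turn z)
      = blinfun_apply quarter_turn (blinfun_apply (plane_projection A) z)" for z
    using arg_cong[OF plane_projection_quarter_turn, of "\<lambda>T. blinfun_apply T z"] by simp
  then show ?thesis
    by (simp add: rotation_def blinfun.bilinear_simps ip_add_left ip_add_right ip_diff_right
        ip_plane_projection ip_quarter_turn)
qed

lemma rotation_inverse: "rotation A t o\<^sub>L rotation A (- t) = id_blinfun"
  by (simp add: rotation_add rotation_zero)

lemma rotation_unitary: "rotation A t \<in> unitaries smul"
proof (rule unitaryI)
  show "scalar_linear (rotation A t)" by (rule scalar_linear_pieces)
  have inv: "blinfun_apply (rotation A s) (blinfun_apply (rotation A (- s)) x) = x" for s x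
    using arg_cong[OF rotation_inverse, of "\<lambda>T. blinfun_apply T x"] by simp
  show "surj (blinfun_apply (rotation A t))" using inv by (metis surjI)
  fix x
  have "ip (blinfun_apply (rotation A t) x) (blinfun_apply (rotation A t) x) = ip x x"
    using inv[of "- t" x] by (simp add: ip_rotation)
  then show "norm (blinfun_apply (rotation A t) x) = norm x"
    unfolding ip_self of_real_eq_iff by simp
qed

lemma norm_unitary_le: "g \<in> unitaries smul \<Longrightarrow> norm g \<le> 1"
  by (rule norm_blinfun_bound) (simp_all add: unitary_norm)

lemma norm_plane_projection: "norm (plane_projection A) \<le> 1"
proof -
  have "norm (id_blinfun - reflection A) \<le> 1 + 1"
    by (intro order_trans[OF norm_triangle_ineq4] add_mono norm_unitary_le unitary_id reflection_unitary)
  then show ?thesis by (simp add: plane_projection_def)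
qed

text \<open>
  The bound is uniform in \<open>A\<close>, so that one angle makes the rotations for all index sets small at once.
\<close>
lemma norm_rotation: "norm (rotation A t - id_blinfun) \<le> \<bar>cos t - 1\<bar> + \<bar>sin t\<bar>"
proof -
  let ?w = "(cos t - 1) *\<^sub>R id_blinfun + sin t *\<^sub>R quarter_turn"
  have "norm (rotation A t - id_blinfun) = norm (plane_projection A o\<^sub>L ?w)"
    by (simp add: rotation_def)
  also have "\<dots> \<le> norm (plane_projection A) * norm ?w" by (rule norm_blinfun_compose)
  also have "\<dots> \<le> 1 * norm ?w" by (intro mult_right_mono norm_plane_projection) simp
  also have "\<dots> \<le> norm ((cos t - 1) *\<^sub>R (id_blinfun :: 'h \<Rightarrow>\<^sub>L 'h)) + norm (sin t *\<^sub>R quarter_turn)"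
    by (simp only: mult_1 norm_triangle_ineq)
  also have "\<dots> \<le> \<bar>cos t - 1\<bar> * 1 + \<bar>sin t\<bar> * 1"
    unfolding norm_scaleR
    by (intro add_mono mult_left_mono norm_unitary_le unitary_id quarter_turn_unitary) auto
  finally show ?thesis by simp
qed

lemma compact_operator_plane_projection:
  assumes "finite A" shows "compact_operator (plane_projection A)"
proof (rule compact_operator_finite_rank[where M = 1])
  show fin: "finite (A \<times> (UNIV :: bool set))" using assms by simp
  have unit: "norm (e p) = 1" for p
    using orthonormal_norm[OF onb_orthonormal[OF onb_e]] by simp
  fix x
  have "ip (blinfun_apply (plane_projection A) x) (e p) = (if p \<in> A \<times> UNIV then ip x (e p) else 0)" for p
    by (cases p) (simp add: ip_plane_projection plane_projection_e)
  then have "((\<lambda>p. smul (if p \<in> A \<times> UNIV then ip x (e p) else 0) (e p)) has_sum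
      blinfun_apply (plane_projection A) x) UNIV"
    using onb_expansion[OF onb_e, of "blinfun_apply (plane_projection A) x"] by simp
  moreover have "((\<lambda>p. smul (if p \<in> A \<times> UNIV then ip x (e p) else 0) (e p)) has_sum
      (\<Sum>p\<in>A \<times> UNIV. smul (ip x (e p)) (e p))) UNIV"
    by (rule has_sum_finite_neutralI[OF fin]) auto
  ultimately show "blinfun_apply (plane_projection A) x = (\<Sum>p\<in>A \<times> UNIV. smul (ip x (e p)) (e p))"
    by (rule has_sum_unique)
  show "nsq (ip x (e p)) \<le> 1 * (norm x)\<^sup>2" for p
    using cauchy_schwarz[of x "e p"] by (simp add: unit)
qed

text \<open>
  The rotations by all angles form a connected set of compact perturbations of the identity, which
  contains the identity.
\<close>
lemma rotation_finite:
  assumes "finite A" shows "rotation A t \<in> unitaries_compact_0 smul"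
proof (rule unitaries_compact_0I)
  show "connected (range (rotation A))"
    unfolding rotation_def by (intro connected_continuous_image continuous_intros) auto
  show "range (rotation A) \<subseteq> unitaries_compact smul"
  proof
    fix g assume "g \<in> range (rotation A)"
    then obtain s where g: "g = rotation A s" by blast
    have "compact_operator (g - id_blinfun)"
      by (simp add: g rotation_def compact_operator_compose_right
          compact_operator_plane_projection assms)
    then show "g \<in> unitaries_compact smul"
      by (simp add: g unitaries_compact_def rotation_unitary)
  qed
  show "id_blinfun \<in> range (rotation A)" using rotation_zero by (metis rangeI)
qed (auto intro: unitaries_compact_0_id)

end


section \<open>Fixed vectors of commuting isometries indexed by an almost disjoint family\<close>

text \<open>
  The sets are the branches of the infinite binary tree, given by their nodes.  Two different branches
  share only the nodes above the level at which they part.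
\<close>
lemma almost_disjoint_family:
  obtains A :: "nat set \<Rightarrow> nat set"
  where "\<And>X. infinite (A X)" "\<And>X Y. X \<noteq> Y \<Longrightarrow> finite (A X \<inter> A Y)"
proof
  define c where "c = (\<lambda>X n. to_nat (map (\<lambda>i. i \<in> X) [0..<n]))" for X :: "nat set"
  have same_level: "n = m" if "c X n = c Y m" for X Y n m
    using arg_cong[of _ _ length, OF inj_onD[OF inj_to_nat that[unfolded c_def]]] by simp
  show "infinite (range (c X))" for X
    using same_level by (intro range_inj_infinite injI) blast
  fix X Y :: "nat set" assume "X \<noteq> Y"
  then obtain k where k: "(k \<in> X) \<noteq> (k \<in> Y)" by blast
  have "range (c X) \<inter> range (c Y) \<subseteq> c X ` {..k}"
  proof
    fix a assume "a \<in> range (c X) \<inter> range (c Y)"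
    then obtain n m where nm: "a = c X n" "a = c Y m" by blast
    then have [simp]: "m = n" using same_level by metis
    have "map (\<lambda>i. i \<in> X) [0..<n] = map (\<lambda>i. i \<in> Y) [0..<n]"
      using nm by (simp add: c_def)
    then have "\<not> k < n" using k by auto
    then show "a \<in> c X ` {..k}" using nm by auto
  qed
  then show "finite (range (c X) \<inter> range (c Y))" using finite_surj by blast
qed

text \<open>
  The union of countably many sets on which \<open>f\<close> approaches its infimum is again countable.
\<close>
lemma countable_set_attains_infimum:
  fixes f :: "'x set \<Rightarrow> real"
  assumes "\<And>S T. S \<subseteq> T \<Longrightarrow> f T \<le> f S" "\<And>S. 0 \<le> f S"
  obtains S where "countable S" "\<And>T. countable T \<Longrightarrow> f S \<le> f T"
proof -
  define m where "m = (INF S\<in>{S. countable S}. f S)"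
  have bdd: "bdd_below (f ` {S. countable S})" using assms(2) by (auto simp: bdd_below_def)
  have m: "m \<le> f S" if "countable S" for S
    unfolding m_def using that by (intro cINF_lower bdd) simp
  have "\<exists>S. countable S \<and> f S < m + 1 / Suc n" for n
    using cINF_less_iff[of "{S. countable S}" f "m + 1 / Suc n"] bdd
    by (auto simp: m_def[symmetric])
  then obtain S where S: "\<And>n. countable (S n)" "\<And>n. f (S n) < m + 1 / Suc n" by metis
  have "f (\<Union>n. S n) \<le> m"
  proof (rule field_le_epsilon)
    fix d :: real assume "d > 0"
    then obtain n where "1 / Suc n < d" using nat_approx_posE by blast
    moreover have "f (\<Union>n. S n) \<le> f (S n)" by (rule assms(1)) blast
    ultimately show "f (\<Union>n. S n) \<le> m + d" using S(2)[of n] by linarith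
  qed
  then show thesis using that[of "\<Union>n. S n"] S(1) m by force
qed

context conj_hilbert_space begin

text \<open>
  The midpoint of two almost shortest vectors stays in the convex set, so by the parallelogram law
  the two vectors are close to each other and a minimizing sequence converges.
\<close>
lemma min_norm_exists:
  assumes C: "closed C" "convex C" "C \<noteq> {}"
  shows "\<exists>w\<in>C. \<forall>x\<in>C. norm w \<le> norm (x :: 'h)"
proof -
  define d where "d = (INF x\<in>C. (norm x)\<^sup>2)"
  have bdd: "bdd_below ((\<lambda>x. (norm x)\<^sup>2) ` C)" by (auto simp: bdd_below_def intro: exI[of _ 0])
  have d: "d \<le> (norm x)\<^sup>2" if "x \<in> C" for x
    unfolding d_def using that by (intro cINF_lower bdd)
  have "\<exists>x\<in>C. (norm x)\<^sup>2 < d + 1 / Suc n" for n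
    using cINF_less_iff[OF C(3) bdd, of "d + 1 / Suc n"] by (auto simp: d_def[symmetric])
  then obtain x where x: "\<And>n. x n \<in> C" "\<And>n. (norm (x n))\<^sup>2 < d + 1 / Suc n" by metis
  have est: "(norm (x m - x n))\<^sup>2 < 2 / Suc m + 2 / Suc n" for m n
  proof -
    have "(1/2) *\<^sub>R x m + (1/2) *\<^sub>R x n \<in> C" using C(2) x(1) by (simp add: convex_def)
    then have "d \<le> (norm ((1/2) *\<^sub>R (x m + x n)))\<^sup>2" using d by (simp add: scaleR_add_right)
    then have "4 * d \<le> (norm (x m + x n))\<^sup>2" by (simp add: power_divide)
    then show ?thesis using parallelogram[of "x m" "x n"] x(2)[of m] x(2)[of n] by simp
  qed
  have "Cauchy x"
  proof (rule metric_CauchyI)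
    fix r :: real assume "r > 0"
    then have "r\<^sup>2 / 4 > 0" by simp
    then obtain N where N: "1 / Suc N < r\<^sup>2 / 4" using nat_approx_posE by blast
    have "dist (x m) (x n) < r" if mn: "m \<ge> N" "n \<ge> N" for m n
    proof -
      have "1 / Suc m \<le> 1 / Suc N" "1 / Suc n \<le> 1 / Suc N" using mn by (simp_all add: frac_le)
      then have "(norm (x m - x n))\<^sup>2 < r\<^sup>2" using est[of m n] N by simp
      then show ?thesis unfolding dist_norm using \<open>r > 0\<close> by (metis power2_less_imp_less less_imp_le)
    qed
    then show "\<exists>N. \<forall>m\<ge>N. \<forall>n\<ge>N. dist (x m) (x n) < r" by blast
  qed
  then obtain w where w: "x \<longlonglongrightarrow> w" using Cauchy_convergent convergent_def by blast
  have "w \<in> C" using C(1) x(1) w closed_sequentially by blast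
  moreover have "norm w \<le> norm y" if "y \<in> C" for y
  proof -
    have "(\<lambda>n. (norm (x n))\<^sup>2) \<longlonglongrightarrow> (norm w)\<^sup>2" by (intro tendsto_intros w)
    moreover have "(\<lambda>n. d + 1 / Suc n) \<longlonglongrightarrow> d + 0"
      by (intro tendsto_intros LIMSEQ_Suc lim_1_over_n)
    ultimately have "(norm w)\<^sup>2 \<le> d + 0"
      by (rule LIMSEQ_le) (use x(2) less_imp_le in blast)
    then have "(norm w)\<^sup>2 \<le> (norm y)\<^sup>2" using d[OF that] by linarith
    then show ?thesis by (rule power2_le_imp_le) simp
  qed
  ultimately show ?thesis by blast
qed

text \<open>
  For a set \<open>S\<close> of indices let \<open>K S\<close> be the closed convex hull of the vectors
  \<open>r (\<Union>X\<in>F. A X) v\<close> with \<open>F\<close> a finite subset of \<open>S\<close>, all of which are near \<open>v\<close>.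
  The minimal norm in \<open>K S\<close> decreases in \<open>S\<close>, so among countable sets it is smallest for some \<open>S\<close>.  If \<open>X\<close> is
  outside \<open>S\<close> and \<open>w\<close> is the shortest vector of \<open>K S\<close>, the midpoint of \<open>w\<close> and
  \<open>r (A X) w\<close> lies in \<open>K (insert X S)\<close> and is not shorter than \<open>w\<close>.  By the
  parallelogram law two vectors of equal norm with this property coincide.
\<close>
lemma fixed_vector_nearby:
  fixes r :: "nat set \<Rightarrow> ('h \<Rightarrow>\<^sub>L 'h)" and A :: "'x \<Rightarrow> nat set"
  assumes iso: "\<And>B x. norm (blinfun_apply (r B) x) = norm x"
    and union: "\<And>B C x. finite (B \<inter> C) \<Longrightarrow>
      blinfun_apply (r B) (blinfun_apply (r C) x) = blinfun_apply (r (B \<union> C)) x"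
    and near: "\<And>B. dist (blinfun_apply (r B) v) v \<le> d"
    and disj: "\<And>X Y. X \<noteq> Y \<Longrightarrow> finite (A X \<inter> A Y)"
  shows "\<exists>w S. countable S \<and> dist w v \<le> d \<and> (\<forall>X. X \<notin> S \<longrightarrow> blinfun_apply (r (A X)) w = w)"
proof -
  define G where "G = (\<lambda>S. {blinfun_apply (r (\<Union>X\<in>F. A X)) v | F. finite F \<and> F \<subseteq> S})"
  define K where "K = (\<lambda>S. closure (convex hull (G S)))"
  define f where "f = (\<lambda>S. INF x\<in>K S. norm x)"
  have Gmono: "G S \<subseteq> G T" if "S \<subseteq> T" for S T using that unfolding G_def by blast
  have Kmono: "K S \<subseteq> K T" if "S \<subseteq> T" for S T
    unfolding K_def by (intro closure_mono hull_mono Gmono that)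
  have "G S \<noteq> {}" for S unfolding G_def by blast
  then have Kne: "K S \<noteq> {}" for S by (simp add: K_def)
  have bdd: "bdd_below (norm ` K S)" for S by (auto simp: bdd_below_def intro: exI[of _ 0])
  have "G S \<subseteq> cball v d" for S using near by (auto simp: G_def dist_commute)
  then have "convex hull (G S) \<subseteq> cball v d" for S by (rule hull_minimal) simp
  then have Kball: "K S \<subseteq> cball v d" for S
    unfolding K_def by (intro closure_minimal) auto
  have fmono: "f T \<le> f S" if "S \<subseteq> T" for S T
    unfolding f_def by (rule cINF_superset_mono[OF Kne bdd Kmono[OF that]]) simp
  have fpos: "0 \<le> f S" for S unfolding f_def by (rule cINF_greatest[OF Kne]) simp
  obtain S where S: "countable S" "\<And>T. countable T \<Longrightarrow> f S \<le> f T"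
    using countable_set_attains_infimum[of f] fmono fpos by metis
  obtain w where w: "w \<in> K S" "\<And>x. x \<in> K S \<Longrightarrow> norm w \<le> norm x"
    using min_norm_exists[of "K S"] Kne[of S] by (auto simp: K_def convex_closure)
  have "norm w \<le> f S" unfolding f_def by (rule cINF_greatest[OF Kne w(2)])
  have move: "blinfun_apply (r (A X)) x \<in> K (insert X S)" if "X \<notin> S" "x \<in> K S" for X x
  proof -
    let ?R = "blinfun_apply (r (A X))"
    have "?R ` G S \<subseteq> G (insert X S)"
    proof
      fix y assume "y \<in> ?R ` G S"
      then obtain F where F: "finite F" "F \<subseteq> S" "y = ?R (blinfun_apply (r (\<Union>X\<in>F. A X)) v)"
        by (auto simp: G_def)
      have "finite (\<Union>Y\<in>F. A X \<inter> A Y)"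
        using F \<open>X \<notin> S\<close> by (intro finite_UN_I disj) auto
      then have "finite (A X \<inter> (\<Union>X\<in>F. A X))" by (simp only: Int_UN_distrib)
      then have "y = blinfun_apply (r (\<Union>X\<in>insert X F. A X)) v" using F(3) union by simp
      then show "y \<in> G (insert X S)" unfolding G_def using F by blast
    qed
    then have "convex hull (?R ` G S) \<subseteq> convex hull (G (insert X S))" by (rule hull_mono)
    moreover have "?R ` (convex hull (G S)) = convex hull (?R ` G S)"
      by (rule convex_hull_linear_image) (rule bounded_linear.linear[OF blinfun.bounded_linear_right])
    ultimately have "?R ` (convex hull (G S)) \<subseteq> convex hull (G (insert X S))" by simp
    then have "?R ` K S \<subseteq> K (insert X S)"
      unfolding K_def
      by (intro image_closure_subset continuous_intros) (auto intro: closure_subset[THEN subsetD])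
    then show ?thesis using that by blast
  qed
  have "blinfun_apply (r (A X)) w = w" if "X \<notin> S" for X
  proof -
    let ?y = "blinfun_apply (r (A X)) w"
    have "w \<in> K (insert X S)" using w(1) Kmono[of S "insert X S"] by blast
    moreover have "convex (K (insert X S))" by (simp add: K_def convex_closure)
    ultimately have "(1/2) *\<^sub>R w + (1/2) *\<^sub>R ?y \<in> K (insert X S)"
      using move[OF that w(1)] by (simp add: convex_def)
    then have "f (insert X S) \<le> norm ((1/2) *\<^sub>R w + (1/2) *\<^sub>R ?y)"
      unfolding f_def by (rule cINF_lower[OF bdd])
    moreover have "f S \<le> f (insert X S)" using S by simp
    ultimately have "norm w \<le> norm ((1/2) *\<^sub>R (w + ?y))"
      using \<open>norm w \<le> f S\<close> by (simp add: scaleR_add_right)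
    then have "(2 * norm w)\<^sup>2 \<le> (norm (w + ?y))\<^sup>2" by (intro power_mono) simp_all
    then have "4 * (norm w)\<^sup>2 \<le> (norm (w + ?y))\<^sup>2" by (simp add: power_mult_distrib)
    then have "(norm (w - ?y))\<^sup>2 \<le> 0" using parallelogram[of w ?y] unfolding iso by linarith
    then show ?thesis by simp
  qed
  moreover have "dist w v \<le> d" using w(1) Kball[of S] by (auto simp: dist_commute)
  ultimately show ?thesis using S(1) by blast
qed

end


section \<open>A rotation that acts trivially\<close>

context plane_sequence begin

lemma small_rotation_angle:
  assumes "\<delta> > 0"
  obtains N :: nat where "N > 0" "\<And>A. dist (rotation A (pi / 2 / N)) id_blinfun < \<delta>"
proof -
  have "isCont (\<lambda>t :: real. \<bar>cos t - 1\<bar> + \<bar>sin t\<bar>) 0" by (intro continuous_intros)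
  then have "(\<lambda>t :: real. \<bar>cos t - 1\<bar> + \<bar>sin t\<bar>) \<midarrow>0\<rightarrow> 0" by (simp add: isCont_def)
  from LIM_D[OF this \<open>\<delta> > 0\<close>] obtain \<eta> where \<eta>: "\<eta> > 0"
    "\<And>t :: real. t \<noteq> 0 \<Longrightarrow> \<bar>t\<bar> < \<eta> \<Longrightarrow> \<bar>cos t - 1\<bar> + \<bar>sin t\<bar> < \<delta>" by auto
  obtain N where N: "pi / 2 / \<eta> < real N" using reals_Archimedean2 by blast
  moreover have "0 < pi / 2 / \<eta>" using \<eta>(1) by simp
  ultimately have "0 < real N" by linarith
  have "pi / 2 / N < \<eta>" using N \<eta>(1) \<open>0 < real N\<close> by (simp add: field_simps)
  moreover have "0 < pi / 2 / N" using \<open>0 < real N\<close> by simp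
  ultimately have "\<bar>cos (pi / 2 / N) - 1\<bar> + \<bar>sin (pi / 2 / N)\<bar> < \<delta>"
    by (intro \<eta>(2)) linarith+
  then have "dist (rotation A (pi / 2 / N)) id_blinfun < \<delta>" for A
    using norm_rotation[of A "pi / 2 / N"] unfolding dist_norm by linarith
  then show thesis by (intro that[of N]) (use \<open>0 < real N\<close> in auto)
qed

text \<open>
  A vector is close to one that almost all rotations by a small fraction of the right angle fix,
  so that almost all rotations by the right angle fix it too.  By separability of the
  representation space only countably many rotations of the uncountable family fail to fix some
  vector of a dense set.
\<close>
lemma rotation_in_kernel:
  fixes \<rho> :: "('h \<Rightarrow>\<^sub>L 'h) \<Rightarrow> ('v::banach \<Rightarrow>\<^sub>L 'v)"
  assumes V: "conj_hilbert_space cV (sV :: 'l::real_algebra_1 \<Rightarrow> 'v \<Rightarrow> 'v) iV nV"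
    and sep: "separable_space (euclidean :: 'v topology)"
    and hom: "\<And>g h. g \<in> unitaries smul \<Longrightarrow> h \<in> unitaries smul \<Longrightarrow> \<rho> (g o\<^sub>L h) = \<rho> g o\<^sub>L \<rho> h"
    and iso: "\<And>g x. g \<in> unitaries smul \<Longrightarrow> norm (blinfun_apply (\<rho> g) x) = norm x"
    and ker: "\<And>g. g \<in> unitaries_compact_0 smul \<Longrightarrow> \<rho> g = id_blinfun"
    and cont: "\<And>v. continuous_on (unitaries smul) (\<lambda>g. blinfun_apply (\<rho> g) v)"
  shows "\<exists>A. infinite A \<and> infinite (- A) \<and> \<rho> (rotation A (pi / 2)) = id_blinfun"
proof -
  interpret V: conj_hilbert_space cV sV iV nV by (rule V)
  obtain A :: "nat set \<Rightarrow> nat set" where A: "\<And>X. infinite (A X)"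
    "\<And>X Y. X \<noteq> Y \<Longrightarrow> finite (A X \<inter> A Y)" using almost_disjoint_family by blast
  have union: "blinfun_apply (\<rho> (rotation B t)) (blinfun_apply (\<rho> (rotation C t)) x)
      = blinfun_apply (\<rho> (rotation (B \<union> C) t)) x" if "finite (B \<inter> C)" for B C t x
  proof -
    have "rotation B t = rotation (B - C) t o\<^sub>L rotation (B \<inter> C) t"
      by (subst rotation_disjoint) (auto intro: arg_cong[of _ _ "\<lambda>B. rotation B t"])
    then have "\<rho> (rotation B t) = \<rho> (rotation (B - C) t)"
      using that by (auto simp: hom rotation_unitary ker rotation_finite intro: blinfun_eqI)
    moreover have "rotation (B \<union> C) t = rotation (B - C) t o\<^sub>L rotation C t"
      by (subst rotation_disjoint) (auto intro: arg_cong[of _ _ "\<lambda>B. rotation B t"])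
    ultimately show ?thesis by (simp add: hom rotation_unitary)
  qed
  have id: "\<rho> id_blinfun = id_blinfun" by (rule ker[OF unitaries_compact_0_id])
  have near: "\<exists>w S. countable S \<and> dist w v \<le> d \<and>
      (\<forall>X. X \<notin> S \<longrightarrow> blinfun_apply (\<rho> (rotation (A X) (pi / 2))) w = w)" if "d > 0" for v d
  proof -
    have "\<exists>\<delta>>0. \<forall>g\<in>unitaries smul. dist g id_blinfun < \<delta> \<longrightarrow>
        dist (blinfun_apply (\<rho> g) v) (blinfun_apply (\<rho> id_blinfun) v) < d"
      using cont[of v] unitary_id that unfolding continuous_on_iff by blast
    then obtain \<delta> where \<delta>: "\<delta> > 0" "\<And>g. g \<in> unitaries smul \<Longrightarrow> dist g id_blinfun < \<delta> \<Longrightarrow>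
        dist (blinfun_apply (\<rho> g) v) v < d" by (auto simp: id)
    obtain N :: nat where N: "N > 0" "\<And>A. dist (rotation A (pi / 2 / N)) id_blinfun < \<delta>"
      using small_rotation_angle[OF \<delta>(1)] by blast
    define t where "t = pi / 2 / N"
    have "\<exists>w S. countable S \<and> dist w v \<le> d \<and>
        (\<forall>X. X \<notin> S \<longrightarrow> blinfun_apply (\<rho> (rotation (A X) t)) w = w)"
    proof (rule V.fixed_vector_nearby)
      show "norm (blinfun_apply (\<rho> (rotation B t)) x) = norm x" for B x
        by (rule iso[OF rotation_unitary])
      show "dist (blinfun_apply (\<rho> (rotation B t)) v) v \<le> d" for B
        using \<delta>(2)[OF rotation_unitary N(2)] unfolding t_def by (rule less_imp_le)
    qed (use union A(2) in auto)
    then obtain w S where w: "countable S" "dist w v \<le> d"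
      "\<And>X. X \<notin> S \<Longrightarrow> blinfun_apply (\<rho> (rotation (A X) t)) w = w" by blast
    have power: "blinfun_apply (\<rho> (rotation (A X) (real n * t))) w = w" if "X \<notin> S" for X n
    proof (induction n)
      case (Suc n)
      have "rotation (A X) (real (Suc n) * t) = rotation (A X) t o\<^sub>L rotation (A X) (real n * t)"
        by (simp add: rotation_add algebra_simps)
      then show ?case using Suc w(3)[OF that] by (simp add: hom rotation_unitary)
    qed (simp add: rotation_zero id)
    have "X \<notin> S \<Longrightarrow> blinfun_apply (\<rho> (rotation (A X) (pi / 2))) w = w" for X
      using power[of X N] N(1) by (simp add: t_def)
    then show ?thesis using w by blast
  qed
  obtain D :: "'v set" where D: "countable D" "closure D = UNIV"
    using sep by (auto simp: separable_space_def)
  have "\<exists>w S. countable S \<and> dist w v \<le> 1 / Suc m \<and>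
      (\<forall>X. X \<notin> S \<longrightarrow> blinfun_apply (\<rho> (rotation (A X) (pi / 2))) w = w)" for v and m :: nat
    by (rule near) simp
  then obtain w S where w: "\<And>v m. countable (S v m)" "\<And>v m. dist (w v m) v \<le> 1 / Suc m"
    "\<And>v m X. X \<notin> S v m \<Longrightarrow> blinfun_apply (\<rho> (rotation (A X) (pi / 2))) (w v m) = w v m"
    by metis
  have "countable (\<Union>v\<in>D. \<Union>m. S v m)" using D(1) w(1) by auto
  moreover have "uncountable (UNIV :: nat set set)"
    unfolding uncountable_def using Cantors_theorem[of UNIV] by (metis Pow_UNIV empty_not_UNIV)
  ultimately obtain X where X: "X \<notin> (\<Union>v\<in>D. \<Union>m. S v m)" by (metis UNIV_eq_I)
  have "blinfun_apply (\<rho> (rotation (A X) (pi / 2))) x = x" for x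
  proof -
    let ?T = "blinfun_apply (\<rho> (rotation (A X) (pi / 2)))"
    have "closed {x. ?T x = x}" by (intro closed_Collect_eq continuous_intros)
    moreover have "x \<in> closure {x. ?T x = x}"
      unfolding closure_approachable
    proof (intro allI impI)
      fix d :: real assume "d > 0"
      then have "d / 2 > 0" by simp
      then obtain v where v: "v \<in> D" "dist v x < d / 2"
        using D(2) closure_approachable[of x D] by (metis UNIV_I)
      obtain m :: nat where m: "1 / Suc m < d / 2" using nat_approx_posE[OF \<open>d / 2 > 0\<close>] by blast
      have "dist (w v m) x < d"
        using dist_triangle[of "w v m" x v] w(2)[of v m] v(2) m by linarith
      moreover have "?T (w v m) = w v m" using X v(1) by (intro w(3)) blast
      ultimately show "\<exists>y\<in>{x. ?T x = x}. dist y x < d" by blast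
    qed
    ultimately show ?thesis by (simp add: closure_closed)
  qed
  then have "\<rho> (rotation (A X) (pi / 2)) = id_blinfun" by (intro blinfun_eqI) simp
  moreover have "infinite (- A X)"
  proof
    assume "finite (- A X)"
    moreover have "A (- X) \<subseteq> (A X \<inter> A (- X)) \<union> - A X" by blast
    moreover have "finite (A X \<inter> A (- X))" by (rule A(2)) blast
    ultimately show False using A(1)[of "- X"] by (meson finite_UnI finite_subset)
  qed
  ultimately show ?thesis using A(1) by blast
qed

end


section \<open>Normal subgroups that contain a rotation by the right angle\<close>

lemma countable_infinite_bij:
  assumes "countable A" "infinite A" "countable B" "infinite B"
  obtains h where "bij_betw h A B"
proof -
  have "bij_betw (from_nat_into B \<circ> to_nat_on A) A B"
    using bij_betw_trans[OF to_nat_on_infinite[OF assms(1,2)] bij_betw_from_nat_into[OF assms(3,4)]] .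
  then show thesis using that by blast
qed

text \<open>
  Both \<open>A\<close> and its complement are infinite, so that the rotation moves and fixes subspaces of
  infinite dimension.
\<close>
locale quarter_turn_normal_subgroup = plane_sequence conj smul ip nsq e
  for conj :: "'k::real_algebra_1 \<Rightarrow> 'k" and smul :: "'k \<Rightarrow> 'h::banach \<Rightarrow> 'h"
    and ip :: "'h \<Rightarrow> 'h \<Rightarrow> 'k" and nsq :: "'k \<Rightarrow> real" and e :: "nat \<times> bool \<Rightarrow> 'h" +
  fixes N :: "('h \<Rightarrow>\<^sub>L 'h) set" and A :: "nat set"
  assumes separable: "separable_space (euclidean :: 'h topology)"
    and infinite_dim: "infinite_dimensional smul"
    and normal: "N \<lhd> unitary_group smul"
    and A: "infinite A" "infinite (- A)"
    and quarter_turn_in: "rotation A (pi / 2) \<in> N"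
begin

lemma N_unitary: "g \<in> N \<Longrightarrow> g \<in> unitaries smul"
  using normal_imp_subgroup[OF normal, THEN subgroup.subset] by (auto simp: unitary_group_def)

lemma N_compose: "g \<in> N \<Longrightarrow> h \<in> N \<Longrightarrow> g o\<^sub>L h \<in> N"
  using subgroup.m_closed[OF normal_imp_subgroup[OF normal]] by (simp add: unitary_group_def)

lemma N_uinv: "g \<in> N \<Longrightarrow> uinv g \<in> N"
  using subgroup.m_inv_closed[OF normal_imp_subgroup[OF normal]] inv_unitary_group[OF N_unitary]
  by metis

lemma N_conjugate: "g \<in> N \<Longrightarrow> p \<in> unitaries smul \<Longrightarrow> p o\<^sub>L g o\<^sub>L uinv p \<in> N"
  using normal.inv_op_closed2[OF normal, of p g] inv_unitary_group[of p]
  by (simp add: unitary_group_def)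

text \<open>
  All partial signed permutations of this kind are conjugate to the rotation, because both have
  infinitely many planes and an infinite-dimensional space of fixed vectors.
\<close>
lemma signed_swap_in_N:
  assumes f: "orthonormal I f" and R: "R \<subseteq> I" "infinite R"
    and \<sigma>: "inj_on \<sigma> R" "\<sigma> ` R \<subseteq> I - R" and rest: "infinite (I - R - \<sigma> ` R)"
  shows "\<exists>t\<in>N. (\<forall>i\<in>R. blinfun_apply t (f i) = f (\<sigma> i) \<and> blinfun_apply t (f (\<sigma> i)) = - f i) \<and>
    (\<forall>i\<in>I - R - \<sigma> ` R. blinfun_apply t (f i) = f i)"
proof -
  have inj: "inj_on f I" using f by (rule orthonormal_inj)
  have "orthonormal (f ` I) (\<lambda>b. b)"
    using f inj by (auto simp: orthonormal_def dest: inj_onD)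
  then obtain B where B: "f ` I \<subseteq> B" "onb B (\<lambda>b. b)" using onb_extend by blast
  define Z where "Z = B - f ` R - f ` \<sigma> ` R"
  have cB: "countable B" using orthonormal_countable[OF separable onb_orthonormal[OF B(2)]] .
  have cI: "countable I" using orthonormal_countable[OF separable f] .
  have fZ: "f ` (I - R - \<sigma> ` R) \<subseteq> Z"
    using B(1) inj R \<sigma> unfolding Z_def by (auto dest!: inj_onD)
  have "infinite (f ` (I - R - \<sigma> ` R))"
    using rest finite_imageD[OF _ inj_on_subset[OF inj]] by blast
  then have "infinite Z" using fZ finite_subset by blast
  obtain \<beta> where \<beta>: "bij_betw \<beta> A R"
    using countable_infinite_bij[of A R] A(1) R countable_subset[OF R(1) cI] by auto
  have "infinite ((- A) \<times> (UNIV :: bool set))"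
    using A(2) by (auto dest: finite_cartesian_productD1)
  moreover have "countable Z" using cB by (simp add: Z_def)
  ultimately obtain \<gamma> where \<gamma>: "bij_betw \<gamma> ((- A) \<times> (UNIV :: bool set)) Z"
    using countable_infinite_bij[of "(- A) \<times> (UNIV :: bool set)" Z] \<open>infinite Z\<close> by blast
  define \<phi> where "\<phi> = (\<lambda>p. if fst p \<in> A
    then (if snd p then f (\<sigma> (\<beta> (fst p))) else f (\<beta> (fst p))) else \<gamma> p)"
  have \<beta>R: "bij_betw (\<lambda>p. \<beta> (fst p)) (A \<times> {b}) R" for b :: bool
    using bij_betw_trans[of fst "A \<times> {b}" A \<beta> R] \<beta>
    by (auto simp: bij_betw_def inj_on_def comp_def)
  have "bij_betw (f \<circ> (\<lambda>p. \<beta> (fst p))) (A \<times> {False}) (f ` R)"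
    by (rule bij_betw_trans[OF \<beta>R inj_on_imp_bij_betw[OF inj_on_subset[OF inj R(1)]]])
  then have 1: "bij_betw \<phi> (A \<times> {False}) (f ` R)"
    by (rule bij_betw_cong[THEN iffD1, rotated]) (auto simp: \<phi>_def)
  have "inj_on (f \<circ> \<sigma>) R"
    using \<sigma> by (intro comp_inj_on inj_on_subset[OF inj]) auto
  then have "bij_betw ((f \<circ> \<sigma>) \<circ> (\<lambda>p. \<beta> (fst p))) (A \<times> {True}) ((f \<circ> \<sigma>) ` R)"
    by (rule bij_betw_trans[OF \<beta>R inj_on_imp_bij_betw])
  then have 2: "bij_betw \<phi> (A \<times> {True}) (f ` \<sigma> ` R)"
    unfolding image_comp by (rule bij_betw_cong[THEN iffD1, rotated]) (auto simp: \<phi>_def)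
  have 3: "bij_betw \<phi> ((- A) \<times> UNIV) Z"
    using \<gamma> by (rule bij_betw_cong[THEN iffD1, rotated]) (auto simp: \<phi>_def)
  have "f ` R \<inter> f ` \<sigma> ` R = {}" using \<sigma> R inj by (auto dest!: inj_onD)
  then have "bij_betw \<phi> (A \<times> {False} \<union> A \<times> {True} \<union> (- A) \<times> UNIV) (f ` R \<union> f ` \<sigma> ` R \<union> Z)"
    by (intro bij_betw_combine 1 2 3) (auto simp: Z_def)
  moreover have "A \<times> {False} \<union> A \<times> {True} \<union> (- A) \<times> UNIV = UNIV" by auto
  moreover have "f ` R \<subseteq> B" "f ` \<sigma> ` R \<subseteq> B" using B(1) R(1) \<sigma>(2) by blast+
  then have "f ` R \<union> f ` \<sigma> ` R \<union> Z = B" unfolding Z_def by blast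
  ultimately have \<phi>: "bij_betw \<phi> UNIV B" by simp
  have "onb UNIV \<phi>" using onb_reindex[OF B(2) \<phi>] .
  then obtain g where g: "g \<in> unitaries smul" "\<And>p. blinfun_apply g (e p) = \<phi> p"
    using onb_unitary[OF onb_e] by blast
  define t where "t = g o\<^sub>L rotation A (pi / 2) o\<^sub>L uinv g"
  have "blinfun_apply (uinv g) (\<phi> p) = e p" for p using uinv_left[OF g(1), of "e p"] g(2) by simp
  then have t: "blinfun_apply t (\<phi> (n, b)) = (if n \<in> A
      then (if b then -1 else 1) *\<^sub>R \<phi> (n, \<not> b) else \<phi> (n, b))" for n b
    by (simp add: t_def rotation_e g(2) blinfun.bilinear_simps)
  have "blinfun_apply t (f i) = f (\<sigma> i) \<and> blinfun_apply t (f (\<sigma> i)) = - f i" if "i \<in> R" for i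
  proof -
    have "i \<in> \<beta> ` A" using \<beta> that by (simp add: bij_betw_def)
    then obtain n where "n \<in> A" "\<beta> n = i" by blast
    then show ?thesis using t[of n False] t[of n True] by (simp add: \<phi>_def)
  qed
  moreover have "blinfun_apply t (f i) = f i" if "i \<in> I - R - \<sigma> ` R" for i
  proof -
    have "f i \<in> \<phi> ` ((- A) \<times> UNIV)" using that fZ 3 by (auto simp: bij_betw_def)
    then obtain n b where "n \<notin> A" "f i = \<phi> (n, b)" by auto
    then show ?thesis using t[of n b] by simp
  qed
  moreover have "t \<in> N" unfolding t_def by (rule N_conjugate[OF quarter_turn_in g(1)])
  ultimately show ?thesis by blast
qed

text \<open>
  Gram--Schmidt orthonormalization.  The condition on \<open>y\<close> replaces membership of \<open>F\<close> in the span
  of \<open>B\<close>.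
\<close>
lemma finite_orthonormal_cover:
  assumes "finite F"
  shows "\<exists>B. finite B \<and> orthonormal B (\<lambda>b. b) \<and> (\<forall>y. (\<forall>b\<in>B. ip y b = 0) \<longrightarrow> (\<forall>f\<in>F. ip y f = 0))"
  using assms
proof (induction F rule: finite_induct)
  case empty
  show ?case by (rule exI[of _ "{}"]) (simp add: orthonormal_def)
next
  case (insert f F)
  then obtain B where B: "finite B" "orthonormal B (\<lambda>b. b)"
    "\<And>y f. (\<And>b. b \<in> B \<Longrightarrow> ip y b = 0) \<Longrightarrow> f \<in> F \<Longrightarrow> ip y f = 0" by blast
  define s where "s = (\<Sum>b\<in>B. smul (ip f b) b)"
  have fs: "ip (f - s) b = 0" if "b \<in> B" for b
    using ip_sum_orthonormal[OF B(2,1) order_refl, of b "\<lambda>b. ip f b"] that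
    by (simp add: ip_diff_left s_def)
  have ys: "ip y s = 0" if "\<And>b. b \<in> B \<Longrightarrow> ip y b = 0" for y
    by (rule ip_zero_sym)
      (simp add: s_def ip_sum_left ip_smul_left ip_zero_sym[OF that] cong: sum.cong)
  show ?case
  proof (cases "f = s")
    case True
    then show ?thesis using B ys by (intro exI[of _ B]) auto
  next
    case False
    define r where "r = (f - s) /\<^sub>R norm (f - s)"
    have "norm r = 1" using False by (simp add: r_def)
    then have "ip r r = 1" by (simp add: ip_self_one_iff)
    moreover have r0: "ip r b = 0" "ip b r = 0" if "b \<in> B" for b
      using fs[OF that] ip_zero_sym[OF fs[OF that]] by (simp_all add: r_def)
    ultimately have "orthonormal (insert r B) (\<lambda>b. b)"
      using B(2) by (auto simp: orthonormal_def)
    moreover have "ip y f = 0" if "\<And>b. b \<in> insert r B \<Longrightarrow> ip y b = 0" for y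
    proof -
      have "f = norm (f - s) *\<^sub>R r + s" using False by (simp add: r_def)
      then have "ip y f = norm (f - s) *\<^sub>R ip y r + ip y s"
        by (metis ip_add_right ip_scaleR_right)
      then show ?thesis using that ys by simp
    qed
    ultimately show ?thesis using B by (intro exI[of _ "insert r B"]) auto
  qed
qed

text \<open>
  A finite orthonormal set extends to a basis, which is infinite and thus has a further member.
\<close>
lemma unit_vector_orthogonal:
  assumes "finite F" shows "\<exists>x. norm x = 1 \<and> (\<forall>f\<in>F. ip x f = 0)"
proof -
  obtain B where B: "finite B" "orthonormal B (\<lambda>b. b)"
    "\<And>y f. (\<And>b. b \<in> B \<Longrightarrow> ip y b = 0) \<Longrightarrow> f \<in> F \<Longrightarrow> ip y f = 0"
    using finite_orthonormal_cover[OF assms] by blast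
  obtain C where C: "B \<subseteq> C" "onb C (\<lambda>b. b)" using onb_extend[OF B(2)] by blast
  have "infinite C" by (rule onb_infinite[OF infinite_dim C(2)])
  then obtain x where x: "x \<in> C" "x \<notin> B" using B(1) by (meson finite_subset subsetI)
  have Co: "orthonormal C (\<lambda>b. b)" by (rule onb_orthonormal[OF C(2)])
  have "norm x = 1" using orthonormal_norm[OF Co x(1)] by simp
  moreover have "ip x b = 0" if "b \<in> B" for b
    using orthonormal_diff[OF Co x(1), of b] that C(1) x(2) by auto
  ultimately show ?thesis using B(3) by blast
qed

text \<open>
  Each vector is chosen orthogonal to the previous vectors and to their images under \<open>u\<close> and under
  its inverse.  The inverse images give the orthogonality of an earlier vector to the image of a
  later one.
\<close>
lemma orthonormal_sequence_with_orthogonal_images: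
  assumes u: "u \<in> unitaries smul"
  obtains x :: "nat \<Rightarrow> 'h" where "orthonormal UNIV x"
    "\<And>m n. m \<noteq> n \<Longrightarrow> ip (x m) (blinfun_apply u (x n)) = 0"
proof -
  let ?P = "\<lambda>x (n::nat) r. norm r = 1 \<and> (\<forall>m<n. ip r (x m) = 0 \<and> ip r (blinfun_apply u (x m)) = 0
      \<and> ip r (blinfun_apply (uinv u) (x m)) = 0)"
  have "\<exists>x. \<forall>n. ?P x n (x n)"
  proof (rule dependent_wellorder_choice)
    fix n :: nat and x :: "nat \<Rightarrow> 'h"
    have "finite (x ` {..<n} \<union> (\<lambda>m. blinfun_apply u (x m)) ` {..<n}
        \<union> (\<lambda>m. blinfun_apply (uinv u) (x m)) ` {..<n})" by simp
    from unit_vector_orthogonal[OF this] show "\<exists>r. ?P x n r" by (auto simp: image_Un ball_Un)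
  qed auto
  then obtain x where x: "\<And>n. ?P x n (x n)" by blast
  have norm: "norm (x n) = 1" for n using x by simp
  have orth: "ip (x n) (x m) = 0" and u1: "ip (x n) (blinfun_apply u (x m)) = 0"
    and u2: "ip (x n) (blinfun_apply (uinv u) (x m)) = 0" if "m < n" for m n
    using x[of n] that by simp_all
  have "ip (x m) (blinfun_apply u (x n)) = 0" if "m \<noteq> n" for m n
  proof (cases "n < m")
    case False
    then have "ip (blinfun_apply (uinv u) (x m)) (x n) = 0"
      using ip_zero_sym[OF u2[of m n]] that by simp
    then show ?thesis by (simp add: ip_uinv[OF u])
  qed (rule u1)
  moreover have "ip (x m) (x n) = (if m = n then 1 else 0)" for m n
    using orth[of m n] orth[of n m] ip_zero_sym[of "x n" "x m"] norm[of m] ip_self_one_iff[of "x m"]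
    by (cases m n rule: linorder_cases) simp_all
  ultimately show thesis using that[of x] by (auto simp: orthonormal_def)
qed

text \<open>
  With a sequence \<open>x\<close> as above, one signed swap takes \<open>x (4 * n)\<close> to \<open>x (4 * n + 1)\<close>, and the
  inverse of another one takes this vector to the image of \<open>x (4 * n)\<close> under \<open>u\<close>.  The other
  indices leave room for the fixed vectors.
\<close>
lemma agrees_on_sequence:
  assumes u: "u \<in> unitaries smul"
  obtains k and x :: "nat \<Rightarrow> 'h" where "k \<in> N" "orthonormal UNIV x"
    "\<And>n. blinfun_apply k (x n) = blinfun_apply u (x n)"
proof -
  obtain x :: "nat \<Rightarrow> 'h" where x: "orthonormal UNIV x"
    "\<And>m n. m \<noteq> n \<Longrightarrow> ip (x m) (blinfun_apply u (x n)) = 0"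
    using orthonormal_sequence_with_orthogonal_images[OF u] by blast
  have x': "ip (blinfun_apply u (x m)) (x n) = 0" if "m \<noteq> n" for m n
    using x(2)[of n m] that ip_zero_sym by simp
  define R :: "nat set" where "R = range ((*) 4)"
  have R: "infinite R" unfolding R_def by (rule range_inj_infinite) (simp add: inj_def)
  have \<sigma>: "inj_on Suc R" "Suc ` R \<subseteq> UNIV - R" by (auto simp: R_def) presburger
  have "range (\<lambda>n. 4 * n + 2) \<subseteq> UNIV - R - Suc ` R" by (auto simp: R_def) presburger+
  moreover have "infinite (range (\<lambda>n::nat. 4 * n + 2))"
    by (rule range_inj_infinite) (simp add: inj_def)
  ultimately have rest: "infinite (UNIV - R - Suc ` R)" using finite_subset by blast
  obtain t1 where t1: "t1 \<in> N" "\<And>i. i \<in> R \<Longrightarrow> blinfun_apply t1 (x i) = x (Suc i)"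
    using signed_swap_in_N[OF x(1) subset_UNIV R \<sigma> rest] by blast
  define y where "y = (\<lambda>n. if n \<in> R then blinfun_apply u (x n) else x n)"
  have y: "orthonormal UNIV y"
    using x x' orthonormal_unitary[OF x(1) u] by (auto simp: orthonormal_def y_def)
  obtain t2 where t2: "t2 \<in> N" "\<And>i. i \<in> R \<Longrightarrow> blinfun_apply t2 (y i) = y (Suc i)"
    using signed_swap_in_N[OF y subset_UNIV R \<sigma> rest] by blast
  show thesis
  proof (rule that)
    show "uinv t2 o\<^sub>L t1 \<in> N" by (intro N_compose N_uinv t1 t2)
    show "orthonormal UNIV (\<lambda>n. x (4 * n))"
      by (rule orthonormal_reindex[OF x(1)]) (auto simp: inj_def)
    fix n
    have "4 * n \<in> R" "Suc (4 * n) \<notin> R" using \<sigma>(2) by (auto simp: R_def)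
    then have "blinfun_apply t2 (blinfun_apply u (x (4 * n))) = blinfun_apply t1 (x (4 * n))"
      using t2(2)[of "4 * n"] t1(2)[of "4 * n"] by (simp add: y_def)
    then show "blinfun_apply (uinv t2 o\<^sub>L t1) (x (4 * n)) = blinfun_apply u (x (4 * n))"
      using uinv_left[OF N_unitary[OF t2(1)]] by (metis blinfun_apply_blinfun_compose)
  qed
qed

text \<open>
  A basis is arranged into a sequence of copies of an infinite-dimensional space such that \<open>u\<close> acts on
  the copy \<open>1\<close> and fixes the others.  Let \<open>E S\<close> act as \<open>u\<close> on each copy with index in \<open>S\<close>.  The
  signed swaps along \<open>1 - 2\<close>, \<open>3 - 4\<close>, ... and along \<open>2 - 3\<close>, \<open>4 - 5\<close>, ... conjugate \<open>E S\<close>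
  for the set \<open>S\<close> of odd numbers to the operators for the sets \<open>2, 4, ...\<close> and \<open>1, 2, 4, ...\<close>.
  These differ by the factor \<open>u\<close>.  Both are congruent to \<open>E S\<close> modulo a normal subgroup that contains
  the swaps, so \<open>u\<close> lies in it.  The copy \<open>0\<close> keeps the fixed space of the swaps
  infinite-dimensional.
\<close>
lemma fixes_sequence_in_N:
  assumes u: "u \<in> unitaries smul" and x: "orthonormal UNIV x"
    and fix_x: "\<And>n :: nat. blinfun_apply u (x n) = x n"
  shows "u \<in> N"
proof -
  \<comment> \<open>The index \<open>1\<close> of the distinguished copy is kept as a literal in the rewriting below.\<close>
  note One_nat_def [simp del]
  have xinj: "inj x" using x by (rule orthonormal_inj)
  have "orthonormal (range x) (\<lambda>b. b)"
    using x by (auto simp: orthonormal_def inj_eq[OF xinj])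
  then obtain B where B: "range x \<subseteq> B" "onb B (\<lambda>b. b)" using onb_extend by blast
  define X where "X = range (\<lambda>n. x (2 * n))"
  define C where "C = B - X"
  have cB: "countable B" using orthonormal_countable[OF separable onb_orthonormal[OF B(2)]] .
  have "range (\<lambda>n. x (2 * n + 1)) \<subseteq> C"
    using B(1) by (auto simp: C_def X_def inj_eq[OF xinj]) presburger
  moreover have "infinite (range (\<lambda>n. x (2 * n + 1)))"
    by (rule range_inj_infinite) (simp add: inj_def inj_eq[OF xinj])
  ultimately have "infinite C" using finite_subset by blast
  moreover have "countable C" using cB by (simp add: C_def)
  ultimately obtain \<beta> where \<beta>: "bij_betw \<beta> ({1} \<times> UNIV :: (nat \<times> nat) set) C"
    using countable_infinite_bij[of "{1} \<times> UNIV :: (nat \<times> nat) set" C]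
    by (auto simp: finite_cartesian_product_iff)
  have "infinite X"
    unfolding X_def by (rule range_inj_infinite) (simp add: inj_def inj_eq[OF xinj])
  moreover have "countable X" by (simp add: X_def)
  moreover have "infinite ((- {1}) \<times> UNIV :: (nat \<times> nat) set)"
  proof
    assume "finite ((- {1}) \<times> UNIV :: (nat \<times> nat) set)"
    moreover have "0 \<in> - {1 :: nat}" by simp
    ultimately show False using finite_cartesian_productD2 infinite_UNIV_nat by blast
  qed
  ultimately obtain \<gamma> where \<gamma>: "bij_betw \<gamma> ((- {1}) \<times> UNIV :: (nat \<times> nat) set) X"
    using countable_infinite_bij[of "(- {1}) \<times> UNIV :: (nat \<times> nat) set" X] by blast
  define b where "b = (\<lambda>p. if fst p = 1 then \<beta> p else \<gamma> p)"
  have 1: "bij_betw b ({1} \<times> UNIV) C"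
    using \<beta> by (rule bij_betw_cong[THEN iffD1, rotated]) (auto simp: b_def)
  have 2: "bij_betw b ((- {1}) \<times> UNIV) X"
    using \<gamma> by (rule bij_betw_cong[THEN iffD1, rotated]) (auto simp: b_def)
  have "bij_betw b ({1} \<times> UNIV \<union> (- {1}) \<times> UNIV) (C \<union> X)"
    by (intro bij_betw_combine 1 2) (auto simp: C_def)
  moreover have "{1} \<times> UNIV \<union> (- {1}) \<times> UNIV = (UNIV :: (nat \<times> nat) set)" by auto
  moreover have "C \<union> X = B" using B(1) by (auto simp: C_def X_def)
  ultimately have "bij_betw b UNIV B" by simp
  from onb_reindex[OF B(2) this] have b: "onb UNIV b" by simp
  have bo: "orthonormal UNIV b" by (rule onb_orthonormal[OF b])
  have b_ip: "ip (b p) (b q) = (if p = q then 1 else 0)" for p q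
    using bo unfolding orthonormal_def by blast
  have ub: "blinfun_apply u (b (n, i)) = b (n, i)" if "n \<noteq> 1" for n i
  proof -
    have "b (n, i) \<in> X" using 2 that by (auto simp: bij_betw_def)
    then show ?thesis using fix_x by (auto simp: X_def)
  qed
  have u_copy: "ip (blinfun_apply u (b (1, i))) (b (n, j)) = 0" if "n \<noteq> 1" for n i j
    using unitary_ip[OF u, of "b (1, i)" "b (n, j)"] that by (simp add: ub b_ip)
  note ulin = unitary_scalar_linear[OF u]

  \<comment> \<open>The operator \<open>\<phi> n\<close> exchanges the copies \<open>1\<close> and \<open>n\<close>, so \<open>w n i\<close> is the image of
    the basis vector \<open>b (n, i)\<close> under \<open>u\<close> transported to the copy \<open>n\<close>.\<close>
  have "\<exists>g. g \<in> unitaries smul \<and>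
      (\<forall>m i. blinfun_apply g (b (m, i)) = b (Transposition.transpose 1 n m, i))" for n
  proof -
    have "bij (\<lambda>p :: nat \<times> nat. (Transposition.transpose 1 n (fst p), snd p))"
      by (rule involuntory_imp_bij) simp
    from onb_unitary[OF b onb_reindex[OF b this]] show ?thesis by fastforce
  qed
  then obtain \<phi> where \<phi>: "\<And>n. \<phi> n \<in> unitaries smul"
    "\<And>n m i. blinfun_apply (\<phi> n) (b (m, i)) = b (Transposition.transpose 1 n m, i)" by metis
  have \<phi>1: "blinfun_apply (\<phi> n) (b (1, i)) = b (n, i)" for n i by (simp add: \<phi>(2))
  note \<phi>lin = unitary_scalar_linear[OF \<phi>(1)]
  define w where "w = (\<lambda>n i. blinfun_apply (\<phi> n) (blinfun_apply u (b (1, i))))"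
  have w_ip: "ip (w n i) (b (m, j)) = 0" if "m \<noteq> n" for n m i j
  proof -
    have "b (m, j) = blinfun_apply (\<phi> n) (b (Transposition.transpose 1 n m, j))" by (simp add: \<phi>(2))
    moreover have "Transposition.transpose 1 n m \<noteq> 1"
      using that by (metis transpose_apply_first transpose_involutory)
    ultimately show ?thesis by (simp add: w_def unitary_ip[OF \<phi>(1)] u_copy)
  qed
  have w1: "w 1 i = blinfun_apply u (b (1, i))" for i
    using scalar_linear_agree[OF b \<phi>lin[of 1] scalar_linear_intros(1), of "blinfun_apply u (b (1, i))"]
    by (simp add: w_def \<phi>(2) split_paired_all)
  have uw: "blinfun_apply u (w n i) = w n i" if "n \<noteq> 1" for n i
  proof -
    have "ip (w n i) (b p) = 0 \<or> blinfun_apply u (b p) = blinfun_apply id_blinfun (b p)" for p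
      using w_ip[of "fst p" n i "snd p"] ub[of n "snd p"] that by (cases "fst p = n"; cases p) auto
    then show ?thesis
      using scalar_linear_agree[OF b ulin scalar_linear_intros(1), of "w n i"] by simp
  qed

  define f where "f = (\<lambda>S p. if fst p \<in> S then w (fst p) (snd p) else b p)"
  have f_ip: "ip (f S (n, i)) (b (m, j)) = 0" if "m \<noteq> n" for S n i m j
    using that by (simp add: f_def w_ip b_ip)
  have f_onb: "onb UNIV (f S)" for S
  proof -
    have "ip (f S (n, i)) (f S (m, j)) = (if (n, i) = (m, j) then 1 else 0)" for n i m j
    proof (cases "n = m")
      case True
      then show ?thesis
        by (simp add: f_def w_def unitary_ip[OF \<phi>(1)] unitary_ip[OF u] b_ip)
    next
      case False
      have "ip (f S (n, i)) (b p) = 0 \<or> ip (b p) (f S (m, j)) = 0" for p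
      proof (cases p)
        case (Pair l q)
        then show ?thesis
          using False f_ip[of l n S i q] ip_zero_sym[OF f_ip[of l m S j q]] by (cases "l = n") auto
      qed
      then have "ip (f S (n, i)) (f S (m, j)) = 0" by (intro onb_ip_zero[OF b])
      then show ?thesis using False by simp
    qed
    then have "orthonormal UNIV (f S)" by (simp add: orthonormal_def)
    moreover have "y = 0" if y: "\<forall>p\<in>UNIV. ip y (f S p) = 0" for y
    proof (rule onb_total[OF b])
      fix p :: "nat \<times> nat"
      obtain n j where p: "p = (n, j)" by (cases p)
      show "ip y (b p) = 0"
      proof (cases "n \<in> S")
        case True
        define z where "z = blinfun_apply (uinv u) (blinfun_apply (uinv (\<phi> n)) y)"
        have z: "ip z (b (1, i)) = 0" for i
        proof -
          have "ip z (b (1, i)) = ip y (w n i)"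
            by (simp add: z_def w_def ip_uinv[OF u] ip_uinv[OF \<phi>(1)])
          also have "\<dots> = 0" using y True bspec[OF y, of "(n, i)"] by (simp add: f_def)
          finally show ?thesis .
        qed
        have "ip z (b q) = 0 \<or> ip (b q) (blinfun_apply (uinv u) (b (1, j))) = 0" for q
        proof (cases q)
          case (Pair l i)
          have "ip (blinfun_apply (uinv u) (b (1, j))) (b (l, i)) = 0" if "l \<noteq> 1"
            using that by (simp add: ip_uinv[OF u] ub b_ip)
          then show ?thesis using z Pair ip_zero_sym by (cases "l = 1") auto
        qed
        then have "ip z (blinfun_apply (uinv u) (b (1, j))) = 0" by (intro onb_ip_zero[OF b])
        then have "ip (blinfun_apply (uinv (\<phi> n)) y) (b (1, j)) = 0"
          by (simp add: z_def ip_uinv[OF u] u)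
        then show ?thesis by (simp add: p ip_uinv[OF \<phi>(1)] \<phi>1)
      next
        case False
        then show ?thesis using bspec[OF y, of p] by (simp add: f_def p)
      qed
    qed
    ultimately show ?thesis by (simp add: onb_def)
  qed
  have "\<exists>g. g \<in> unitaries smul \<and> (\<forall>p. blinfun_apply g (b p) = f S p)" for S
    using onb_unitary[OF b f_onb[of S]] by blast
  then obtain E where E: "\<And>S. E S \<in> unitaries smul" "\<And>S p. blinfun_apply (E S) (b p) = f S p"
    by metis
  note Elin = unitary_scalar_linear[OF E(1)]

  have conj: "p o\<^sub>L E S = E (\<pi> ` S) o\<^sub>L p"
    if p: "p \<in> unitaries smul" and "inj \<pi>"
      and pb: "\<And>n i. blinfun_apply p (b (n, i)) = s n *\<^sub>R b (\<pi> n, i)" for p S \<pi> and s :: "nat \<Rightarrow> real"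
  proof (rule scalar_linear_eqI[OF b])
    note plin = unitary_scalar_linear[OF p]
    show "scalar_linear (p o\<^sub>L E S)" "scalar_linear (E (\<pi> ` S) o\<^sub>L p)"
      by (intro scalar_linear_intros plin Elin)+
    have pw: "blinfun_apply p (w n i) = s n *\<^sub>R w (\<pi> n) i" for n i
    proof -
      have "ip (blinfun_apply u (b (1, i))) (b q) = 0 \<or>
          blinfun_apply (p o\<^sub>L \<phi> n) (b q) = blinfun_apply (s n *\<^sub>R \<phi> (\<pi> n)) (b q)" for q
        using u_copy \<phi>1 by (cases q; cases "fst q = 1") (auto simp: pb blinfun.bilinear_simps)
      from scalar_linear_agree[OF b scalar_linear_intros(5)[OF plin \<phi>lin]
          scalar_linear_intros(4)[OF \<phi>lin] this]
      show ?thesis by (simp add: w_def blinfun.bilinear_simps)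
    qed
    fix q
    show "blinfun_apply (p o\<^sub>L E S) (b q) = blinfun_apply (E (\<pi> ` S) o\<^sub>L p) (b q)"
      by (cases q) (simp add: E(2) pb f_def pw blinfun.bilinear_simps inj_image_mem_iff[OF \<open>inj \<pi>\<close>])
  qed

  define odds where "odds = {n :: nat. odd n}"
  define evens where "evens = {n :: nat. even n \<and> n > 0}"
  have inf_copies: "infinite (T \<times> (UNIV :: nat set))" if "T \<noteq> {}" for T :: "nat set"
    using that by (auto dest: finite_cartesian_productD2)
  define \<sigma> where "\<sigma> = (\<lambda>p :: nat \<times> nat. (Suc (fst p), snd p))"
  have \<sigma>inj: "inj_on \<sigma> T" for T by (auto simp: inj_on_def \<sigma>_def)
  have swap: "\<exists>t\<in>N. \<forall>n i. blinfun_apply t (b (n, i)) =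
      (if n \<in> T then b (Suc n, i) else if n \<in> Suc ` T then - b (n - 1, i) else b (n, i))"
    if T: "T \<noteq> {}" "0 \<notin> T" "Suc ` T \<inter> T = {}" for T
  proof -
    have img: "\<sigma> ` (T \<times> UNIV) = Suc ` T \<times> UNIV" by (force simp: \<sigma>_def)
    have "{0} \<times> UNIV \<subseteq> UNIV - T \<times> (UNIV :: nat set) - \<sigma> ` (T \<times> UNIV)" using T(2) by (auto simp: img)
    then have rest: "infinite (UNIV - T \<times> (UNIV :: nat set) - \<sigma> ` (T \<times> UNIV))"
      using inf_copies[of "{0}"] finite_subset by blast
    obtain t where t: "t \<in> N"
      "\<And>p. p \<in> T \<times> UNIV \<Longrightarrow> blinfun_apply t (b p) = b (\<sigma> p) \<and> blinfun_apply t (b (\<sigma> p)) = - b p"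
      "\<And>p. p \<in> UNIV - T \<times> UNIV - \<sigma> ` (T \<times> UNIV) \<Longrightarrow> blinfun_apply t (b p) = b p"
      using signed_swap_in_N[OF bo subset_UNIV inf_copies[OF T(1)] \<sigma>inj _ rest] T(3) unfolding img
      by blast
    have "blinfun_apply t (b (n, i)) =
        (if n \<in> T then b (Suc n, i) else if n \<in> Suc ` T then - b (n - 1, i) else b (n, i))" for n i
      using t(2)[of "(n, i)"] t(2)[of "(n - 1, i)"] t(3)[of "(n, i)"] unfolding img
      by (auto simp: \<sigma>_def)
    then show ?thesis using t(1) by blast
  qed

  have sodds: "n \<in> Suc ` odds \<longleftrightarrow> n \<in> evens" for n
    by (auto simp: odds_def evens_def image_iff) (metis One_nat_def Suc_pred even_Suc)
  have sevens: "n \<in> Suc ` evens \<longleftrightarrow> n \<in> odds \<and> n \<noteq> 1" for n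
    by (auto simp: odds_def evens_def image_iff) (metis One_nat_def Suc_pred even_Suc not_gr_zero odd_pos)
  have "1 \<in> odds" "2 \<in> evens" by (simp_all add: odds_def evens_def)
  then have ne: "odds \<noteq> {}" "evens \<noteq> {}" by blast+
  have zero: "0 \<notin> odds" "0 \<notin> evens" by (simp_all add: odds_def evens_def)
  have disj: "Suc ` odds \<inter> odds = {}" "Suc ` evens \<inter> evens = {}"
    by (auto simp: odds_def evens_def)
  obtain p1 where p1: "p1 \<in> N" "\<And>n i. blinfun_apply p1 (b (n, i)) =
      (if n \<in> odds then b (Suc n, i) else if n \<in> evens then - b (n - 1, i) else b (n, i))"
    using swap[OF ne(1) zero(1) disj(1)] unfolding sodds by blast
  obtain p2 where p2: "p2 \<in> N" "\<And>n i. blinfun_apply p2 (b (n, i)) =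
      (if n \<in> evens then b (Suc n, i) else if n \<in> odds \<and> n \<noteq> 1 then - b (n - 1, i) else b (n, i))"
    using swap[OF ne(2) zero(2) disj(2)] unfolding sevens by blast
  define \<pi>1 where "\<pi>1 = (\<lambda>n. if n \<in> odds then Suc n else n - 1)"
  define \<pi>2 where "\<pi>2 = (\<lambda>n. if n \<in> evens then Suc n else if n = 0 \<or> n = 1 then n else n - 1)"
  have "inj \<pi>1"
    by (rule inj_on_inverseI[of _ \<pi>1]) (auto simp: \<pi>1_def odds_def elim!: evenE oddE)
  have "inj \<pi>2"
    by (rule inj_on_inverseI[of _ \<pi>2]) (auto simp: \<pi>2_def evens_def elim!: evenE oddE)
  have img1: "\<pi>1 ` odds = evens" using sodds by (auto simp: \<pi>1_def)
  have img2: "\<pi>2 ` odds = insert 1 evens"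
  proof (intro equalityI subsetI)
    show "n \<in> insert 1 evens" if "n \<in> \<pi>2 ` odds" for n
      using that by (auto simp: \<pi>2_def evens_def odds_def elim!: oddE)
    fix n assume n: "n \<in> insert 1 evens"
    then have "n = \<pi>2 (if n = 1 then 1 else Suc n)" "(if n = 1 then 1 else Suc n) \<in> odds"
      by (auto simp: \<pi>2_def evens_def odds_def)
    then show "n \<in> \<pi>2 ` odds" by blast
  qed
  have E1: "p1 o\<^sub>L E odds = E evens o\<^sub>L p1"
    unfolding img1[symmetric]
    by (rule conj[OF N_unitary[OF p1(1)] \<open>inj \<pi>1\<close>, of "\<lambda>n. if n \<in> evens then -1 else 1"])
      (auto simp: p1(2) \<pi>1_def odds_def evens_def)
  have E2: "p2 o\<^sub>L E odds = E (insert 1 evens) o\<^sub>L p2"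
    unfolding img2[symmetric]
    by (rule conj[OF N_unitary[OF p2(1)] \<open>inj \<pi>2\<close>, of "\<lambda>n. if n \<in> odds \<and> n \<noteq> 1 then -1 else 1"])
      (auto simp: p2(2) \<pi>2_def odds_def evens_def)
  have uE: "E (insert 1 evens) = u o\<^sub>L E evens"
  proof (rule scalar_linear_eqI[OF b])
    fix p
    have "1 \<notin> evens" by (simp add: evens_def)
    then show "blinfun_apply (E (insert 1 evens)) (b p) = blinfun_apply (u o\<^sub>L E evens) (b p)"
      by (cases p; cases "fst p = 1") (auto simp: E(2) f_def w1 uw ub)
  qed (intro scalar_linear_intros ulin Elin)+

  define q where "q = E odds o\<^sub>L (uinv p2 o\<^sub>L p1) o\<^sub>L uinv (E odds)"
  have "q \<in> N" unfolding q_def by (intro N_conjugate N_compose N_uinv p1 p2 E)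
  have U: "p1 \<in> unitaries smul" "p2 \<in> unitaries smul" using p1 p2 N_unitary by auto
  have "u = p2 o\<^sub>L q o\<^sub>L uinv p1"
  proof (rule blinfun_eqI)
    fix y
    define z where "z = blinfun_apply (uinv (E evens)) y"
    have z: "y = blinfun_apply (E evens) z" by (simp add: z_def E(1))
    have e1: "blinfun_apply (E evens) z = blinfun_apply p1 (blinfun_apply (E odds) (blinfun_apply (uinv p1) z))"
      using arg_cong[OF E1, of "\<lambda>T. blinfun_apply T (blinfun_apply (uinv p1) z)"] U by simp
    have e2: "blinfun_apply (E (insert 1 evens)) z = blinfun_apply p2 (blinfun_apply (E odds) (blinfun_apply (uinv p2) z))"
      using arg_cong[OF E2, of "\<lambda>T. blinfun_apply T (blinfun_apply (uinv p2) z)"] U by simp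
    have "blinfun_apply u y = blinfun_apply (E (insert 1 evens)) z" by (simp add: z uE)
    moreover have "blinfun_apply (p2 o\<^sub>L q o\<^sub>L uinv p1) y
        = blinfun_apply p2 (blinfun_apply (E odds) (blinfun_apply (uinv p2) z))"
      unfolding z e1 q_def by (simp add: U E(1))
    ultimately show "blinfun_apply u y = blinfun_apply (p2 o\<^sub>L q o\<^sub>L uinv p1) y" by (simp add: e2)
  qed
  also have "\<dots> \<in> N" by (intro N_compose N_uinv p1 p2 \<open>q \<in> N\<close>)
  finally show ?thesis .
qed

text \<open>
  An element of \<open>N\<close> that agrees with \<open>u\<close> on an orthonormal sequence reduces the claim to an operator
  that fixes the sequence.
\<close>
lemma N_eq_unitaries: "N = unitaries smul"
proof (intro equalityI subsetI N_unitary)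
  fix u assume u: "u \<in> unitaries smul"
  obtain k and x :: "nat \<Rightarrow> 'h" where k: "k \<in> N" "orthonormal UNIV x"
    "\<And>n. blinfun_apply k (x n) = blinfun_apply u (x n)" using agrees_on_sequence[OF u] by blast
  have kU: "k \<in> unitaries smul" by (rule N_unitary[OF k(1)])
  have "uinv k o\<^sub>L u \<in> N"
  proof (rule fixes_sequence_in_N)
    show "uinv k o\<^sub>L u \<in> unitaries smul" by (intro unitary_compose uinv_unitary kU u)
    show "blinfun_apply (uinv k o\<^sub>L u) (x n) = x n" for n
      by (simp add: kU flip: k(3))
  qed (rule k(2))
  then have "k o\<^sub>L (uinv k o\<^sub>L u) \<in> N" by (rule N_compose[OF k(1)])
  moreover have "k o\<^sub>L (uinv k o\<^sub>L u) = u" by (rule blinfun_eqI) (simp add: kU)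
  ultimately show "u \<in> N" by simp
qed

end


section \<open>Representations of the quotient group\<close>

context conj_hilbert_space begin

text \<open>
  The representation is studied through its pullback \<open>\<rho>\<close> to the unitary group, whose kernel is a
  normal subgroup.
\<close>
lemma continuous_rep_quotient_trivial:
  fixes smul_V :: "complex \<Rightarrow> 'v::banach \<Rightarrow> 'v"
  assumes separable: "separable_space (euclidean :: 'h topology)"
    and infinite_dim: "infinite_dimensional smul"
    and V: "conj_hilbert_space cnj smul_V ip_V nsq_V"
    and separable_V: "separable_space (euclidean :: 'v topology)"
    and rep: "continuous_unitary_rep (unitary_quotient smul) (unitary_quotient_topology smul) smul_V \<pi>"
  shows "trivial_rep (unitary_quotient smul) \<pi>"
proof -
  interpret V: conj_hilbert_space cnj smul_V ip_V nsq_V by (rule V)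
  let ?G = "unitary_group smul" and ?GV = "unitary_group smul_V"
  let ?C = "unitaries_compact_0 smul"
  let ?q = "\<lambda>g. ?C #>\<^bsub>?G\<^esub> g"
  interpret C: normal ?C ?G by (rule unitaries_compact_0_normal)
  have carrier: "carrier ?G = unitaries smul" by (simp add: unitary_group_def)
  have carrier_V: "carrier ?GV = unitaries smul_V" by (simp add: unitary_group_def)
  have hom_\<pi>: "\<pi> \<in> hom (?G Mod ?C) ?GV"
    and cont_\<pi>: "continuous_map (unitary_quotient_topology smul) euclidean (\<lambda>X. blinfun_apply (\<pi> X) v)" for v
    using rep by (simp_all add: continuous_unitary_rep_def unitary_quotient_def)
  define \<rho> where "\<rho> = (\<lambda>g. \<pi> (?q g))"
  have q_carrier: "?q g \<in> carrier (?G Mod ?C)" if "g \<in> unitaries smul" for g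
    using that by (auto simp: FactGroup_def RCOSETS_def carrier)
  have \<rho>U: "\<rho> g \<in> unitaries smul_V" if "g \<in> unitaries smul" for g
    using hom_in_carrier[OF hom_\<pi> q_carrier[OF that]] by (simp add: \<rho>_def carrier_V)
  have hom: "\<rho> (g o\<^sub>L h) = \<rho> g o\<^sub>L \<rho> h" if "g \<in> unitaries smul" "h \<in> unitaries smul" for g h
  proof -
    have "?q (g o\<^sub>L h) = ?q g \<otimes>\<^bsub>?G Mod ?C\<^esub> ?q h"
      using C.rcos_sum[of g h] that by (simp add: FactGroup_def carrier) (simp add: unitary_group_def)
    then show ?thesis
      using hom_mult[OF hom_\<pi> q_carrier[OF that(1)] q_carrier[OF that(2)]]
      by (simp add: \<rho>_def) (simp add: unitary_group_def)
  qed
  have id: "\<rho> id_blinfun = id_blinfun"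
  proof -
    have "id_blinfun o\<^sub>L id_blinfun = (id_blinfun :: 'h \<Rightarrow>\<^sub>L 'h)" by (rule blinfun_eqI) simp
    then have "\<rho> id_blinfun o\<^sub>L \<rho> id_blinfun = \<rho> id_blinfun"
      using hom[OF unitary_id unitary_id] by simp
    then have "blinfun_apply (\<rho> id_blinfun) (blinfun_apply (\<rho> id_blinfun) x)
        = blinfun_apply (\<rho> id_blinfun) x" for x
      by (metis blinfun_apply_blinfun_compose)
    then show ?thesis
      using V.unitary_bij[OF \<rho>U[OF unitary_id]] by (intro blinfun_eqI) (simp add: bij_def inj_eq)
  qed
  have ker: "\<rho> g = id_blinfun" if "g \<in> ?C" for g
  proof -
    have "?q g = ?q id_blinfun"
      using C.rcos_const[OF group_unitary_group] that unitaries_compact_0_id by simp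
    then show ?thesis using id by (simp add: \<rho>_def)
  qed
  have cont: "continuous_on (unitaries smul) (\<lambda>g. blinfun_apply (\<rho> g) v)" for v
  proof -
    have "continuous_map (top_of_set (unitaries smul)) (unitary_quotient_topology smul) ?q"
      unfolding unitary_quotient_topology_def
      by (rule quotient_imp_continuous_map[OF quotient_map_quotient_topology])
    from continuous_map_compose[OF this cont_\<pi>[of v]] show ?thesis
      by (simp add: \<rho>_def comp_def)
  qed

  obtain B where B: "onb B (\<lambda>b. b)" using onb_extend[of "{}"] by (auto simp: orthonormal_def)
  obtain e :: "nat \<times> bool \<Rightarrow> 'h" where "bij_betw e UNIV B"
    using countable_infinite_bij[of "UNIV :: (nat \<times> bool) set" B]
      orthonormal_countable[OF separable onb_orthonormal[OF B]] onb_infinite[OF infinite_dim B]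
    by (auto simp: finite_prod)
  then interpret plane_sequence conj smul ip nsq e
    by unfold_locales (rule onb_reindex[OF B])
  obtain A where A: "infinite A" "infinite (- A)" "\<rho> (rotation A (pi / 2)) = id_blinfun"
    using rotation_in_kernel[OF V separable_V hom V.unitary_norm[OF \<rho>U] ker cont] by blast
  have "group_hom ?G ?GV \<rho>"
    by (intro group_hom.intro group_hom_axioms.intro group_unitary_group V.group_unitary_group)
      (auto intro!: homI simp: carrier carrier_V \<rho>U, simp add: unitary_group_def hom)
  then have "kernel ?G ?GV \<rho> \<lhd> ?G" by (rule group_hom.normal_kernel)
  moreover have "kernel ?G ?GV \<rho> = {g \<in> unitaries smul. \<rho> g = id_blinfun}"
    by (simp add: kernel_def unitary_group_def)
  ultimately have "{g \<in> unitaries smul. \<rho> g = id_blinfun} \<lhd> ?G" by simp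
  then have "quarter_turn_normal_subgroup conj smul ip nsq e {g \<in> unitaries smul. \<rho> g = id_blinfun} A"
    using separable infinite_dim A rotation_unitary
    by (intro quarter_turn_normal_subgroup.intro quarter_turn_normal_subgroup_axioms.intro
        plane_sequence_axioms) simp_all
  from quarter_turn_normal_subgroup.N_eq_unitaries[OF this]
  have "\<rho> g = id_blinfun" if "g \<in> unitaries smul" for g using that by blast
  then show ?thesis
    by (auto simp: trivial_rep_def unitary_quotient_def FactGroup_def RCOSETS_def carrier \<rho>_def)
qed

end


section \<open>Real, complex and quaternionic scalars\<close>

lemma conj_hilbert_space_real:
  assumes "hilbert_space id smul ip" shows "conj_hilbert_space id smul ip (\<lambda>a :: real. a\<^sup>2)"
proof -
  interpret hilbert_space id smul ip by (rule assms)
  show ?thesis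
  proof
    show "\<exists>L. finite L \<and> (\<forall>a::real. \<exists>t. a = (\<Sum>l\<in>L. t l *\<^sub>R l) \<and> (\<forall>l\<in>L. (t l)\<^sup>2 \<le> a\<^sup>2))"
      by (rule exI[of _ "{1}"]) auto
  qed (simp_all add: power2_eq_square)
qed

lemma conj_hilbert_space_complex:
  assumes "hilbert_space cnj smul ip" shows "conj_hilbert_space cnj smul ip (\<lambda>a. (cmod a)\<^sup>2)"
proof -
  interpret hilbert_space cnj smul ip by (rule assms)
  show ?thesis
  proof
    have "a = (\<Sum>l\<in>{1, \<i>}. (if l = 1 then Re a else Im a) *\<^sub>R l)" for a
      by (simp add: complex_eq_iff)
    then show "\<exists>L. finite L \<and> (\<forall>a. \<exists>t. a = (\<Sum>l\<in>L. t l *\<^sub>R l) \<and> (\<forall>l\<in>L. (t l)\<^sup>2 \<le> (cmod a)\<^sup>2))"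
      by (intro exI[of _ "{1, \<i>}"] conjI allI exI[of _ "\<lambda>l. if l = 1 then Re a else Im a" for a])
        (auto simp: cmod_power2)
  qed (simp_all add: complex_norm_square flip: of_real_power)
qed

lemma conj_hilbert_space_quat:
  assumes "hilbert_space qcnj smul ip"
  shows "conj_hilbert_space qcnj smul ip (\<lambda>a. (qre a)\<^sup>2 + (qi a)\<^sup>2 + (qj a)\<^sup>2 + (qk a)\<^sup>2)"
proof -
  interpret hilbert_space qcnj smul ip by (rule assms)
  let ?n = "\<lambda>a. (qre a)\<^sup>2 + (qi a)\<^sup>2 + (qj a)\<^sup>2 + (qk a)\<^sup>2"
  show ?thesis
  proof
    let ?L = "{Quat 1 0 0 0, Quat 0 1 0 0, Quat 0 0 1 0, Quat 0 0 0 1}"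
    define t where "t = (\<lambda>a l. qre a * qre l + qi a * qi l + qj a * qj l + qk a * qk l)"
    have "a = (\<Sum>l\<in>?L. t a l *\<^sub>R l)" for a
      by (rule quat_eqI) (simp_all add: t_def plus_quat_def scaleR_quat_def zero_quat_def)
    moreover have "(t a l)\<^sup>2 \<le> ?n a" if "l \<in> ?L" for a l
      using that by (auto simp: t_def)
    ultimately show "\<exists>L. finite L \<and> (\<forall>a. \<exists>t. a = (\<Sum>l\<in>L. t l *\<^sub>R l) \<and> (\<forall>l\<in>L. (t l)\<^sup>2 \<le> ?n a))"
      by (intro exI[of _ ?L] conjI allI exI[of _ "t a" for a]) auto
    show "?n a = 0 \<Longrightarrow> a = 0" for a
      by (rule quat_eqI) (simp_all add: zero_quat_def add_nonneg_eq_0_iff)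
  qed (simp_all add: qcnj_mult mult_qcnj,
       simp_all add: qcnj_def plus_quat_def of_real_def scaleR_quat_def one_quat_def)
qed

theorem theorem4p6:
  fixes smul_R :: "real \<Rightarrow> 'h::banach \<Rightarrow> 'h" and ip_R :: "'h \<Rightarrow> 'h \<Rightarrow> real"
    and smul_C :: "complex \<Rightarrow> 'h \<Rightarrow> 'h" and ip_C :: "'h \<Rightarrow> 'h \<Rightarrow> complex"
    and smul_H :: "quat \<Rightarrow> 'h \<Rightarrow> 'h" and ip_H :: "'h \<Rightarrow> 'h \<Rightarrow> quat"
    and smul_V :: "complex \<Rightarrow> 'v::banach \<Rightarrow> 'v" and ip_V :: "'v \<Rightarrow> 'v \<Rightarrow> complex"
  assumes "separable_space (euclidean :: 'h topology)"
    and "hilbert_space cnj smul_V ip_V"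
    and "separable_space (euclidean :: 'v topology)"
  shows "(hilbert_space id smul_R ip_R \<and> infinite_dimensional smul_R \<longrightarrow>
            (\<forall>\<pi>. continuous_unitary_rep (unitary_quotient smul_R)
                    (unitary_quotient_topology smul_R) smul_V \<pi>
                 \<longrightarrow> trivial_rep (unitary_quotient smul_R) \<pi>))
       \<and> (hilbert_space cnj smul_C ip_C \<and> infinite_dimensional smul_C \<longrightarrow>
            (\<forall>\<pi>. continuous_unitary_rep (unitary_quotient smul_C)
                    (unitary_quotient_topology smul_C) smul_V \<pi>
                 \<longrightarrow> trivial_rep (unitary_quotient smul_C) \<pi>))
       \<and> (hilbert_space qcnj smul_H ip_H \<and> infinite_dimensional smul_H \<longrightarrow>
            (\<forall>\<pi>. continuous_unitary_rep (unitary_quotient smul_H)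
                    (unitary_quotient_topology smul_H) smul_V \<pi>
                 \<longrightarrow> trivial_rep (unitary_quotient smul_H) \<pi>))"
proof -
  note V = conj_hilbert_space_complex[OF assms(2)]
  note trivial = conj_hilbert_space.continuous_rep_quotient_trivial[OF _ assms(1) _ V assms(3)]
  show ?thesis
    using trivial[OF conj_hilbert_space_real] trivial[OF conj_hilbert_space_complex]
      trivial[OF conj_hilbert_space_quat] by blast
qed

end
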